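(* Let $\mathcal A\subset C_u(\mathbb J,X)$ be real-linear and positive-invariant, and assume $AP(\mathbb J,X)\subset\mathcal A\subset\mathcal M\mathcal A$. Then all inclusions in the chain $$\mathcal A\subset\mathcal M\mathcal A\subset\mathcal M^2\mathcal A\subset\cdots\subset\mathcal M^n\mathcal A\subset\cdots$$ and, for open $\mathbb J$, in the chain $$\mathcal A\subset\widetilde{\mathcal M}\mathcal A\subset\widetilde{\mathcal M}^2\mathcal A\subset\cdots\subset\widetilde{\mathcal M}^n\mathcal A\subset\cdots$$ are strict.
   Context: $X\neq\{0\}$ is a Banach space over $\mathbb K=\mathbb R$ or $\mathbb C$; $\mathbb J$ is an interval of the form $\mathbb R$, $(\alpha,\infty)$ or $[\alpha,\infty)$, $\alpha\in\mathbb R$. $C_u(\mathbb J,X)$: uniformly continuous functions $\mathbb J\to X$. $AP(\mathbb R,X)$: uniform limits on $\mathbb R$ of $X$-valued trigonometric polynomials ($\sum a_je^{i\omega_jt}$ with $a_j\in X$, $\omega_j\in\mathbb R$ for complex $X$; $\sum(a_j\cos\omega_jt+b_j\sin\omega_jt)$ for real $X$); $AP(\mathbb J,X)$ is the set of restrictions to $\mathbb J$ of elements of $AP(\mathbb R,X)$. Real-linear: $sF+tG\in\mathcal A$ for $F,G\in\mathcal A$, $s,t\in\mathbb R$. Positive-invariant: $F_a\in\mathcal A$ for $F\in\mathcal A$, $a\ge0$, where $F_a(t)=F(t+a)$. For $h\ne0$, $M_hf(t)=\frac1h\int_0^hf(t+s)\,ds$. For $\mathcal B\subset L^1_{loc}(\mathbb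 J,X)$: $\mathcal M\mathcal B=\{f\in L^1_{loc}(\mathbb J,X):M_hf\in\mathcal B\ \forall h>0\}$, $\mathcal M^k\mathcal B=\mathcal M(\mathcal M^{k-1}\mathcal B)$. For open $\mathbb J$, $\mathcal D'(\mathbb J,X)$ is the set of linear continuous maps $\mathcal D(\mathbb J,\mathbb K)\to X$ (locally integrable functions are identified with the distributions they define), $\widetilde M_hT(\varphi)=T(M_{-h}\varphi)$ with $\varphi\in\mathcal D(\mathbb J,\mathbb K)$ extended by $0$ outside $\mathbb J$; $\widetilde{\mathcal M}\mathcal B=\{T\in\mathcal D'(\mathbb J,X):\widetilde M_hT\in\mathcal B\ \forall h>0\}$, $\widetilde{\mathcal M}^k\mathcal B=\widetilde{\mathcal M}(\widetilde{\mathcal M}^{k-1}\mathcal B)$, $\widetilde{\mathcal M}^0\mathcal B=\mathcal B$. *)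

theory Defs
  imports "HOL-Analysis.Analysis"
begin

text \<open>
  A function \<open>J \<rightarrow> X\<close> is an element of \<^term>\<open>extensional J\<close>: the value outside \<open>J\<close> is
  \<^term>\<open>undefined\<close>, so that equality of functions is equality on \<open>J\<close>.
\<close>

definition admissible_interval :: "real set \<Rightarrow> bool" where
  "admissible_interval J \<longleftrightarrow> J = UNIV \<or> (\<exists>\<alpha>. J = {\<alpha><..}) \<or> (\<exists>\<alpha>. J = {\<alpha>..})"

text \<open>Every \<open>'x::banach\<close> is a Banach space over the reals via \<^term>\<open>scaleR\<close>; the following adds
  a complex structure compatible with the norm and with the real one.\<close>

locale complex_banach_space = vector_space scaleC
  for scaleC :: "complex \<Rightarrow> 'x::banach \<Rightarrow> 'x" +
  assumes scaleC_of_real: "scaleC (complex_of_real r) x = r *\<^sub>R x"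
    and norm_scaleC: "norm (scaleC c x) = norm c * norm x"


subsection \<open>Bochner integral in an arbitrary Banach space\<close>

text \<open>
  \<^const>\<open>has_bochner_integral\<close> is restricted to second countable (separable) target spaces.
  This is the same definition without that restriction. The integrand is automatically
  a.e. separably valued, being an \<open>L\<^sup>1\<close>-limit of simple functions.
\<close>

definition bochner_has_integral :: "'a measure \<Rightarrow> ('a \<Rightarrow> 'b::banach) \<Rightarrow> 'b \<Rightarrow> bool" where
  "bochner_has_integral M f x \<longleftrightarrow> f \<in> borel_measurable M \<and>
    (\<exists>s. (\<forall>i. Bochner_Integration.simple_bochner_integrable M (s i)) \<and>
      ((\<lambda>i. \<integral>\<^sup>+t. norm (f t - s i t) \<partial>M) \<longlonglongrightarrow> 0) \<and>
      ((\<lambda>i. Bochner_Integration.simple_bochner_integral M (s i)) \<longlonglongrightarrow> x))"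

lemma bochner_has_integral_eq_has_bochner_integral:
  fixes f :: "'a \<Rightarrow> 'b::{banach, second_countable_topology}"
  shows "bochner_has_integral M f x \<longleftrightarrow> has_bochner_integral M f x"
  unfolding bochner_has_integral_def has_bochner_integral.simps by blast

definition bochner_integrable :: "'a measure \<Rightarrow> ('a \<Rightarrow> 'b::banach) \<Rightarrow> bool" where
  "bochner_integrable M f \<longleftrightarrow> (\<exists>x. bochner_has_integral M f x)"

definition bochner_integral :: "'a measure \<Rightarrow> ('a \<Rightarrow> 'b::banach) \<Rightarrow> 'b" where
  "bochner_integral M f = (THE x. bochner_has_integral M f x)"


subsection \<open>Function classes on \<open>J\<close>\<close>

definition C_u :: "real set \<Rightarrow> (real \<Rightarrow> 'x::banach) set" where
  "C_u J = {f \<in> extensional J. uniformly_continuous_on J f}"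

definition real_linear_on :: "real set \<Rightarrow> (real \<Rightarrow> 'x::banach) set \<Rightarrow> bool" where
  "real_linear_on J A \<longleftrightarrow>
    (\<forall>F\<in>A. \<forall>G\<in>A. \<forall>s t :: real. (\<lambda>u\<in>J. s *\<^sub>R F u + t *\<^sub>R G u) \<in> A)"

definition positive_invariant_on :: "real set \<Rightarrow> (real \<Rightarrow> 'x::banach) set \<Rightarrow> bool" where
  "positive_invariant_on J A \<longleftrightarrow> (\<forall>F\<in>A. \<forall>a\<ge>0. (\<lambda>t\<in>J. F (t + a)) \<in> A)"

definition trig_polys_real :: "(real \<Rightarrow> 'x::banach) set" where
  "trig_polys_real =
    {p. \<exists>(N::nat) \<omega> a b. p = (\<lambda>t. \<Sum>j<N. cos (\<omega> j * t) *\<^sub>R a j + sin (\<omega> j * t) *\<^sub>R b j)}"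

definition trig_polys_complex :: "(complex \<Rightarrow> 'x::banach \<Rightarrow> 'x) \<Rightarrow> (real \<Rightarrow> 'x) set" where
  "trig_polys_complex scaleC =
    {p. \<exists>(N::nat) (\<omega> :: nat \<Rightarrow> real) a.
      p = (\<lambda>t. \<Sum>j<N. scaleC (exp (\<i> * complex_of_real (\<omega> j * t))) (a j))}"

definition uniform_limits :: "(real \<Rightarrow> 'x::banach) set \<Rightarrow> (real \<Rightarrow> 'x) set" where
  "uniform_limits P = {f. \<exists>p. (\<forall>n. p n \<in> P) \<and> uniform_limit UNIV p f sequentially}"

definition AP_real :: "real set \<Rightarrow> (real \<Rightarrow> 'x::banach) set" where
  "AP_real J = (\<lambda>f. restrict f J) ` uniform_limits trig_polys_real"

definition AP_complex :: "(complex \<Rightarrow> 'x::banach \<Rightarrow> 'x) \<Rightarrow> real set \<Rightarrow> (real \<Rightarrow> 'x) set" where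
  "AP_complex scaleC J = (\<lambda>f. restrict f J) ` uniform_limits (trig_polys_complex scaleC)"


subsection \<open>The operators \<open>M\<^sub>h\<close> and \<open>\<M>\<close>\<close>

text \<open>The integral from \<open>0\<close> to \<open>h\<close> is oriented.\<close>

definition mean :: "real \<Rightarrow> (real \<Rightarrow> 'b::banach) \<Rightarrow> real \<Rightarrow> 'b" where
  "mean h f t = (1 / h) *\<^sub>R
    (if 0 \<le> h then bochner_integral (lebesgue_on {0..h}) (\<lambda>s. f (t + s))
     else - bochner_integral (lebesgue_on {h..0}) (\<lambda>s. f (t + s)))"

text \<open>
  Elements of \<open>L\<^sup>1\<^sub>l\<^sub>o\<^sub>c(J,X)\<close> are represented by functions, not by classes modulo a.e. equality;
  a set of classes then corresponds to a set of functions closed under a.e. equality.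
  \<open>ae_closure J B\<close> is the set of all representatives of the classes of elements of \<open>B\<close>.
  Sets of the form \<open>avg_class J B\<close> are closed under a.e. equality for every \<open>B\<close>.
\<close>

definition L1_loc :: "real set \<Rightarrow> (real \<Rightarrow> 'x::banach) set" where
  "L1_loc J = {f \<in> extensional J.
    \<forall>a b. {a..b} \<subseteq> J \<longrightarrow> bochner_integrable (lebesgue_on {a..b}) f}"

definition ae_closure :: "real set \<Rightarrow> (real \<Rightarrow> 'x::banach) set \<Rightarrow> (real \<Rightarrow> 'x) set" where
  "ae_closure J B = {f \<in> L1_loc J. \<exists>g\<in>B. AE t in lebesgue_on J. f t = g t}"

definition avg_class :: "real set \<Rightarrow> (real \<Rightarrow> 'x::banach) set \<Rightarrow> (real \<Rightarrow> 'x) set" where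
  "avg_class J B = {f \<in> L1_loc J. \<forall>h>0. restrict (mean h f) J \<in> B}"


subsection \<open>Vector-valued distributions on an open interval\<close>

text \<open>
  The scalar field \<open>'k\<close> is \<^typ>\<open>real\<close> or \<^typ>\<open>complex\<close>, and \<open>sc\<close> is its action on \<open>X\<close>.
  Test functions on \<open>J\<close> are already extended by \<open>0\<close> to the whole line.
\<close>

definition nth_derivative :: "nat \<Rightarrow> (real \<Rightarrow> 'k::real_normed_vector) \<Rightarrow> real \<Rightarrow> 'k" where
  "nth_derivative n = (\<lambda>g t. vector_derivative g (at t)) ^^ n"

definition test_functions :: "real set \<Rightarrow> (real \<Rightarrow> 'k::{real_normed_field, banach}) set" where
  "test_functions J = {\<phi>. (\<forall>n t. nth_derivative n \<phi> differentiable (at t)) \<and>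
    compact (closure {t. \<phi> t \<noteq> 0}) \<and> closure {t. \<phi> t \<noteq> 0} \<subseteq> J}"

text \<open>Continuity on the inductive limit \<open>\<D>(J,K)\<close> is expressed, as usual, by the seminorm
  estimates on each subspace of test functions supported in a fixed compact subset of \<open>J\<close>.\<close>

definition distributions ::
  "('k::{real_normed_field, banach} \<Rightarrow> 'x::banach \<Rightarrow> 'x) \<Rightarrow> real set \<Rightarrow>
    ((real \<Rightarrow> 'k) \<Rightarrow> 'x) set" where
  "distributions sc J = {T \<in> extensional (test_functions J).
    (\<forall>\<phi>\<in>test_functions J. \<forall>\<psi>\<in>test_functions J. T (\<lambda>t. \<phi> t + \<psi> t) = T \<phi> + T \<psi>) \<and>
    (\<forall>\<phi>\<in>test_functions J. \<forall>c. T (\<lambda>t. c * \<phi> t) = sc c (T \<phi>)) \<and>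
    (\<forall>S. compact S \<and> S \<subseteq> J \<longrightarrow>
      (\<exists>C m. \<forall>\<phi>\<in>test_functions J. closure {t. \<phi> t \<noteq> 0} \<subseteq> S \<longrightarrow>
        norm (T \<phi>) \<le> C * (\<Sum>j\<le>m. SUP t. norm (nth_derivative j \<phi> t))))}"

text \<open>The distribution defined by a locally integrable function.\<close>

definition regular_distribution ::
  "('k::{real_normed_field, banach} \<Rightarrow> 'x::banach \<Rightarrow> 'x) \<Rightarrow> real set \<Rightarrow>
    (real \<Rightarrow> 'x) \<Rightarrow> (real \<Rightarrow> 'k) \<Rightarrow> 'x" where
  "regular_distribution sc J f =
    (\<lambda>\<phi>\<in>test_functions J. bochner_integral (lebesgue_on J) (\<lambda>t. sc (\<phi> t) (f t)))"

definition mean_dist ::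
  "real set \<Rightarrow> real \<Rightarrow> ((real \<Rightarrow> 'k::{real_normed_field, banach}) \<Rightarrow> 'x::banach) \<Rightarrow>
    (real \<Rightarrow> 'k) \<Rightarrow> 'x" where
  "mean_dist J h T = (\<lambda>\<phi>\<in>test_functions J. T (mean (- h) \<phi>))"

definition avg_class_dist ::
  "('k::{real_normed_field, banach} \<Rightarrow> 'x::banach \<Rightarrow> 'x) \<Rightarrow> real set \<Rightarrow>
    ((real \<Rightarrow> 'k) \<Rightarrow> 'x) set \<Rightarrow> ((real \<Rightarrow> 'k) \<Rightarrow> 'x) set" where
  "avg_class_dist sc J B = {T \<in> distributions sc J. \<forall>h>0. mean_dist J h T \<in> B}"

end

theory Submission
  imports Defs "HOL-Real_Asymp.Real_Asymp"
begin

text \<open>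
  Averaging undoes differentiation up to a difference quotient: if \<open>g\<close> has the derivative
  \<open>g'\<close>, then \<open>M\<^sub>h g' = (g(\<cdot> + h) - g) / h\<close>, and the same holds for the
  distributions that the functions define. As \<open>A\<close> is invariant under the difference
  quotients \<open>D\<^sub>h\<close>, the \<open>k\<close>-th derivative of a smooth function whose restriction is in \<open>A\<close> is
  in the \<open>k\<close>-th class of the chain. Conversely, if \<open>f\<close> is smooth and its derivative of order
  \<open>n + 1\<close> is already in the \<open>n\<close>-th class, then applying \<open>M\<^sub>h\<close> \<open>n\<close> times shows that
  \<open>D\<^sub>h\<^sup>n f'\<close> is in \<open>A\<close>, hence uniformly continuous. So it suffices to exhibit one smooth
  almost periodic \<open>f\<close> such that, for each \<open>n\<close> and some \<open>h > 0\<close>, the function \<open>D\<^sub>h\<^sup>n f'\<close>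
  is not uniformly continuous on any half-line. It serves the chain of functions and the
  chain of distributions alike; the common argument is \<open>funpow_averaging_strict\<close>.

  The example is \<open>f = u\<^bsup>1/4\<^esup>\<close> with \<open>u(t) = 2 + cos t + cos (\<surd>2 t)\<close>, times a
  nonzero vector. The trigonometric polynomial \<open>u\<close> has values in \<open>(0, 4]\<close>; positivity,
  which holds because \<open>\<surd>2\<close> is not a quotient of two odd integers, makes \<open>f\<close> smooth, and
  continuity of the fourth root on \<open>[0, 4]\<close> together with the Weierstrass theorem makes \<open>f\<close>
  almost periodic. But \<open>u\<close> comes arbitrarily close to \<open>0\<close>: there are \<open>\<tau>\<^sub>k \<rightarrow> \<infinity>\<close> with
  \<open>u(\<tau>\<^sub>k + x) \<rightarrow> 2 - cos x - cos (\<surd>2 x)\<close> for all \<open>x\<close>, so the translates of \<open>f\<close>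
  converge to a function \<open>\<phi>\<close> which behaves like the square root of \<open>|x|\<close> at \<open>0\<close>. If
  \<open>D\<^sub>h\<^sup>n f'\<close> were uniformly continuous, the bounded function \<open>D\<^sub>h\<^sup>n f\<close> would be Lipschitz,
  and so would be its limit \<open>D\<^sub>h\<^sup>n \<phi>\<close>. For \<open>n h < 1\<close> the shifted terms in \<open>D\<^sub>h\<^sup>n \<phi>\<close>
  only involve points of \<open>(0, 1)\<close>, where \<open>\<phi>\<close> is differentiable, so \<open>\<phi>\<close> itself would be
  Lipschitz at \<open>0\<close> from the right, a contradiction
  (\<open>diff_quot_derivative_not_uniformly_continuous\<close>).

  What remains is to compute means and regular distributions. All integrands that have to
  be evaluated are continuous, and for these the Bochner integral is the Henstock-Kurzweil
  integral (\<open>bochner_has_integral_continuous\<close>), for which the fundamental theorem and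
  integration by parts hold in every Banach space. The real almost periodic functions are
  contained in the complex ones, so \<open>AP_real J \<subseteq> A\<close> holds for both choices of scalars.
\<close>

section \<open>Bochner integrals of continuous functions\<close>

text \<open>
  The usual argument through \<open>\<parallel>\<integral>s - \<integral>t\<parallel> \<le> \<integral>\<parallel>f - s\<parallel> + \<integral>\<parallel>f - t\<parallel>\<close>. Without
  separability of the target space, sums of Borel functions need not be Borel; the
  measurability of \<open>f - s\<close> for a simple function \<open>s\<close> is obtained from the finitely many
  level sets of \<open>s\<close>, on each of which a constant is subtracted.
\<close>
lemma bochner_has_integral_unique:
  fixes f :: "'a \<Rightarrow> 'b::banach"
  assumes "bochner_has_integral M f x" "bochner_has_integral M f y"
  shows "x = y"
proof -
  from assms obtain s t where fm[measurable]: "f \<in> borel_measurable M"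
    and s: "\<And>i. Bochner_Integration.simple_bochner_integrable M (s i)"
    and t: "\<And>i. Bochner_Integration.simple_bochner_integrable M (t i)"
    and S: "(\<lambda>i. \<integral>\<^sup>+t. norm (f t - s i t) \<partial>M) \<longlonglongrightarrow> 0"
    and T: "(\<lambda>i. \<integral>\<^sup>+u. norm (f u - t i u) \<partial>M) \<longlonglongrightarrow> 0"
    and x: "(\<lambda>i. Bochner_Integration.simple_bochner_integral M (s i)) \<longlonglongrightarrow> x"
    and y: "(\<lambda>i. Bochner_Integration.simple_bochner_integral M (t i)) \<longlonglongrightarrow> y"
    unfolding bochner_has_integral_def by blast
  have meas: "(\<lambda>u. ennreal (norm (f u - s u))) \<in> borel_measurable M"
    if "Bochner_Integration.simple_bochner_integrable M s" for s
  proof -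
    have sf: "simple_function M s"
      using that by (auto elim: simple_bochner_integrable.cases)
    have "(\<lambda>u. f u - s u) \<in> borel_measurable M"
    proof (rule measurable_compose_countable'[where I = "s ` space M" and f = "\<lambda>c u. f u - c"])
      show "countable (s ` space M)"
        using sf by (simp add: simple_function_def countable_finite)
      show "s \<in> measurable M (count_space (s ` space M))"
        using sf by (auto simp: simple_function_def measurable_count_space_eq2)
      fix c
      have "continuous_on UNIV (\<lambda>v::'b. v - c)" by (intro continuous_intros)
      from borel_measurable_continuous_on[OF this fm]
      show "(\<lambda>u. f u - c) \<in> borel_measurable M" .
    qed
    from borel_measurable_continuous_on[OF _ this, of norm]
    show ?thesis by (auto intro: continuous_intros)
  qed
  let ?s = "\<lambda>i. Bochner_Integration.simple_bochner_integral M (s i)"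
  let ?t = "\<lambda>i. Bochner_Integration.simple_bochner_integral M (t i)"
  have bound: "ennreal (norm (?s i - ?t i)) \<le> (\<integral>\<^sup>+u. norm (f u - s i u) \<partial>M) + (\<integral>\<^sup>+u. norm (f u - t i u) \<partial>M)" for i
  proof -
    have "ennreal (norm (?s i - ?t i)) = norm (Bochner_Integration.simple_bochner_integral M (\<lambda>x. s i x - t i x))"
      using s t by (subst simple_bochner_integral_diff) auto
    also have "\<dots> \<le> Bochner_Integration.simple_bochner_integral M (\<lambda>x. norm (s i x - t i x))"
      using simple_bochner_integrable_compose2[of "(-)" M "s i" "t i"] s t
      by (auto intro!: simple_bochner_integral_norm_bound)
    also have "\<dots> = (\<integral>\<^sup>+x. norm (s i x - t i x) \<partial>M)"
      using simple_bochner_integrable_compose2[of "\<lambda>x y. norm (x - y)" M "s i" "t i"] s t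
      by (auto intro!: simple_bochner_integral_eq_nn_integral)
    also have "\<dots> \<le> (\<integral>\<^sup>+x. ennreal (norm (f x - s i x)) + ennreal (norm (f x - t i x)) \<partial>M)"
    proof (rule nn_integral_mono)
      fix x
      have "norm (s i x - t i x) \<le> norm (f x - s i x) + norm (f x - t i x)"
        by (metis dual_order.refl norm_diff_triangle_le norm_minus_commute)
      then show "ennreal (norm (s i x - t i x)) \<le> ennreal (norm (f x - s i x)) + ennreal (norm (f x - t i x))"
        by (metis ennreal_leI ennreal_plus norm_ge_zero)
    qed
    also have "\<dots> = (\<integral>\<^sup>+u. norm (f u - s i u) \<partial>M) + (\<integral>\<^sup>+u. norm (f u - t i u) \<partial>M)"
      using meas[OF s] meas[OF t] by (rule nn_integral_add)
    finally show ?thesis .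
  qed
  have "(\<lambda>i. ennreal (norm (?s i - ?t i))) \<longlonglongrightarrow> ennreal 0"
  proof (rule tendsto_sandwich[OF _ _ tendsto_const])
    show "(\<lambda>i. (\<integral>\<^sup>+u. norm (f u - s i u) \<partial>M) + (\<integral>\<^sup>+u. norm (f u - t i u) \<partial>M)) \<longlonglongrightarrow> ennreal 0"
      using tendsto_add[OF S T] by simp
  qed (use bound in auto)
  then have "(\<lambda>i. norm (?s i - ?t i)) \<longlonglongrightarrow> 0"
    by (simp flip: ennreal_0)
  moreover have "(\<lambda>i. norm (?s i - ?t i)) \<longlonglongrightarrow> norm (x - y)"
    by (intro tendsto_intros x y)
  ultimately have "norm (x - y) = 0"
    using LIMSEQ_unique by blast
  then show ?thesis by simp
qed

lemma bochner_integral_eqI: "bochner_has_integral M f x \<Longrightarrow> bochner_integral M f = x"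
  unfolding bochner_integral_def by (blast intro: bochner_has_integral_unique)

lemma bochner_has_integral_cong_AE:
  assumes "bochner_has_integral M f x" "g \<in> borel_measurable M" "AE t in M. f t = g t"
  shows "bochner_has_integral M g x"
proof -
  have "(\<integral>\<^sup>+t. norm (f t - s t) \<partial>M) = (\<integral>\<^sup>+t. norm (g t - s t) \<partial>M)" for s
    by (rule nn_integral_cong_AE) (use assms(3) in \<open>auto elim: eventually_mono\<close>)
  with assms show ?thesis unfolding bochner_has_integral_def by simp
qed

text \<open>
  By completeness of Lebesgue measure, all subsets of \<open>N\<close> are measurable.
\<close>
lemma borel_measurable_lebesgue_on_cong_negligible:
  fixes f g :: "real \<Rightarrow> 'b::topological_space"
  assumes S: "S \<in> sets lebesgue" and f: "f \<in> borel_measurable (lebesgue_on S)"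
    and N: "negligible N" and eq: "\<And>t. t \<in> S - N \<Longrightarrow> g t = f t"
  shows "g \<in> borel_measurable (lebesgue_on S)"
proof (rule measurableI)
  fix U :: "'b set" assume U: "U \<in> sets borel"
  have sub: "A \<in> sets lebesgue" if "A \<subseteq> N" for A
    using that N negligible_subset negligible_imp_sets by blast
  have "f -` U \<inter> S \<in> sets lebesgue"
    using measurable_sets[OF f U] S by (simp add: sets_restrict_space_iff)
  moreover have "g -` U \<inter> S = ((f -` U \<inter> S) - (N \<inter> S)) \<union> (g -` U \<inter> S \<inter> N)"
    using eq by auto
  moreover have "N \<inter> S \<in> sets lebesgue" "g -` U \<inter> S \<inter> N \<in> sets lebesgue"
    by (auto intro: sub)
  ultimately have "g -` U \<inter> S \<in> sets lebesgue"
    by (metis sets.Diff sets.Un)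
  then show "g -` U \<inter> space (lebesgue_on S) \<in> sets (lebesgue_on S)"
    using S by (simp add: sets_restrict_space_iff)
qed auto

lemma AE_lebesgue_on_iff_negligible:
  assumes "S \<in> sets lebesgue"
  shows "(AE t in lebesgue_on S. P t) \<longleftrightarrow> negligible {t\<in>S. \<not> P t}"
proof -
  have "(AE t in lebesgue_on S. P t) \<longleftrightarrow> (AE t in lebesgue. t \<in> S \<longrightarrow> P t)"
    using assms by (subst AE_restrict_space_iff) auto
  also have "\<dots> \<longleftrightarrow> (\<exists>N. negligible N \<and> {t\<in>S. \<not> P t} \<subseteq> N)"
    by (simp add: eventually_ae_filter_negligible)
  also have "\<dots> \<longleftrightarrow> negligible {t\<in>S. \<not> P t}"
    using negligible_subset by blast
  finally show ?thesis .
qed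

lemma bochner_has_integral_cong_negligible:
  fixes f g :: "real \<Rightarrow> 'b::banach"
  assumes S: "S \<in> sets lebesgue" and N: "negligible {t\<in>S. f t \<noteq> g t}"
  shows "bochner_has_integral (lebesgue_on S) f x \<longleftrightarrow> bochner_has_integral (lebesgue_on S) g x"
proof -
  have *: "bochner_has_integral (lebesgue_on S) g x" if "bochner_has_integral (lebesgue_on S) f x"
    "negligible {t\<in>S. f t \<noteq> g t}" for f g :: "real \<Rightarrow> 'b"
  proof (rule bochner_has_integral_cong_AE[OF that(1)])
    have "f \<in> borel_measurable (lebesgue_on S)"
      using that(1) by (simp add: bochner_has_integral_def)
    then show "g \<in> borel_measurable (lebesgue_on S)"
      by (rule borel_measurable_lebesgue_on_cong_negligible[OF S _ that(2)]) simp
    show "AE t in lebesgue_on S. f t = g t"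
      using that(2) by (simp add: AE_lebesgue_on_iff_negligible[OF S])
  qed
  have "negligible {t\<in>S. g t \<noteq> f t}"
    using N by (simp add: eq_commute)
  with * N show ?thesis by blast
qed

lemma simple_bochner_integral_eq_integral:
  fixes s :: "real \<Rightarrow> 'b::banach"
  assumes S: "S \<in> sets lebesgue" and s: "Bochner_Integration.simple_bochner_integrable (lebesgue_on S) s"
    and sub: "{a..b} \<subseteq> S" and 0: "\<And>t. t \<in> S - {a..b} \<Longrightarrow> s t = 0"
  shows "(s has_integral Bochner_Integration.simple_bochner_integral (lebesgue_on S) s) {a..b}"
proof -
  have fin: "finite (s ` S)" and meas: "\<And>y. y \<in> s ` S \<Longrightarrow> s -` {y} \<inter> S \<in> sets lebesgue"
    using s S by (auto elim!: simple_bochner_integrable.cases simp: simple_function_def sets_restrict_space_iff)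
  have pt: "((\<lambda>t. indicat_real {t\<in>S. s t = y} t *\<^sub>R y) has_integral measure (lebesgue_on S) {t\<in>S. s t = y} *\<^sub>R y) {a..b}"
    if "y \<in> s ` S" for y
  proof (cases "y = 0")
    case True
    then show ?thesis by simp
  next
    case False
    let ?E = "{t\<in>S. s t = y}"
    have E: "?E \<subseteq> {a..b}" using 0 False by blast
    have Em: "?E \<in> sets lebesgue" using meas[OF that] by (simp add: vimage_def Int_def conj_commute)
    then have "?E \<in> lmeasurable"
      using E by (intro bounded_set_imp_lmeasurable) (auto intro: bounded_subset[OF bounded_closed_interval])
    then have "((indicat_real ?E) has_integral measure lebesgue ?E) UNIV"
      by (simp add: lmeasurable_iff_has_integral)
    then have "((\<lambda>t. if t \<in> {a..b} then indicat_real ?E t else 0) has_integral measure lebesgue ?E) UNIV"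
      by (rule has_integral_eq[rotated]) (use E in \<open>auto simp: indicator_def\<close>)
    then have "((indicat_real ?E) has_integral measure lebesgue ?E) {a..b}"
      by (simp only: has_integral_restrict_UNIV)
    moreover have "measure (lebesgue_on S) ?E = measure lebesgue ?E"
      using S by (intro measure_restrict_space) auto
    ultimately show ?thesis by (simp only: has_integral_scaleR_left)
  qed
  have "((\<lambda>t. \<Sum>y\<in>s ` S. indicat_real {t\<in>S. s t = y} t *\<^sub>R y) has_integral
      (\<Sum>y\<in>s ` S. measure (lebesgue_on S) {t\<in>S. s t = y} *\<^sub>R y)) {a..b}"
    by (rule has_integral_sum[OF fin]) (rule pt)
  then show ?thesis
    unfolding Bochner_Integration.simple_bochner_integral_def space_lebesgue_on
  proof (rule has_integral_eq[rotated])
    fix t assume "t \<in> {a..b}"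
    then have "t \<in> S" using sub by auto
    then have "(\<Sum>y\<in>s ` S. indicat_real {t\<in>S. s t = y} t *\<^sub>R y) = (\<Sum>y\<in>s ` S. if s t = y then y else 0)"
      by (intro sum.cong) (auto simp: indicator_def)
    also have "\<dots> = s t" using \<open>t \<in> S\<close> by (subst sum.delta'[OF fin]) auto
    finally show "(\<Sum>y\<in>s ` S. indicat_real {t\<in>S. s t = y} t *\<^sub>R y) = s t" .
  qed
qed

text \<open>
  On the compact interval, \<open>F\<close> is a uniform limit of step functions, for which both
  integrals agree.
\<close>
lemma bochner_has_integral_continuous:
  fixes F :: "real \<Rightarrow> 'b::banach"
  assumes S: "S \<in> sets lebesgue" and F: "continuous_on S F" and sub: "{a..b} \<subseteq> S"
    and 0: "\<And>t. t \<in> S - {a..b} \<Longrightarrow> F t = 0"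
  shows "bochner_has_integral (lebesgue_on S) F (integral {a..b} F)"
proof -
  have Fab: "continuous_on {a..b} F" using F sub continuous_on_subset by blast
  then have ucont: "uniformly_continuous_on {a..b} F" by (rule compact_uniformly_continuous) simp
  have Fint: "F integrable_on {a..b}" using Fab by (rule integrable_continuous_real)
  have ex: "\<exists>s. Bochner_Integration.simple_bochner_integrable (lebesgue_on S) s \<and>
      (\<forall>t\<in>{a..b}. norm (F t - s t) \<le> e) \<and> (\<forall>t. t \<notin> {a..b} \<longrightarrow> s t = 0)" if "e > 0" for e
  proof -
    obtain d where d: "d > 0" "\<And>t u. t \<in> {a..b} \<Longrightarrow> u \<in> {a..b} \<Longrightarrow> dist u t < d \<Longrightarrow> dist (F u) (F t) < e"
      using ucont \<open>e > 0\<close> unfolding uniformly_continuous_on_def by metis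
    obtain N :: nat where N: "N > 0" "1 / real N < d"
      using d(1) by (metis nat_approx_posE zero_less_Suc)
    \<comment> \<open>The grid point to the left of \<open>t\<close>, kept inside the interval: it depends on \<open>t\<close> through a floor only,
      so the step function has finitely many values and measurable level sets.\<close>
    define p where "p t = max a (real_of_int \<lfloor>real N * t\<rfloor> / real N)" for t
    define s where "s t = (if t \<in> {a..b} then F (p t) else 0)" for t
    have p: "p t \<in> {a..b}" "dist (p t) t < d" if "t \<in> {a..b}" for t
    proof -
      have "real_of_int \<lfloor>real N * t\<rfloor> / real N \<le> t"
        using N(1) by (simp add: divide_le_eq mult.commute)
      moreover have "t - 1 / real N \<le> real_of_int \<lfloor>real N * t\<rfloor> / real N"
      proof -
        have "real N * t - 1 \<le> real_of_int \<lfloor>real N * t\<rfloor>" by linarith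
        then have "(real N * t - 1) / real N \<le> real_of_int \<lfloor>real N * t\<rfloor> / real N"
          by (rule divide_right_mono) simp
        then show ?thesis using N(1) by (simp add: diff_divide_distrib)
      qed
      ultimately show "p t \<in> {a..b}" "dist (p t) t < d"
        using that N(2) d(1) by (auto simp: p_def dist_real_def)
    qed
    have fl: "(\<lambda>t. \<lfloor>real N * t\<rfloor>) \<in> measurable (lebesgue_on S) (count_space UNIV)"
    proof -
      have "(\<lambda>t. real N * t) \<in> borel_measurable (lebesgue_on S)"
        by (intro continuous_imp_measurable_on_sets_lebesgue continuous_intros S)
      then show ?thesis by measurable
    qed
    have "(\<lambda>t. F (p t)) = (\<lambda>k. F (max a (real_of_int k / real N))) \<circ> (\<lambda>t. \<lfloor>real N * t\<rfloor>)"
      by (auto simp: p_def)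
    then have Fp: "(\<lambda>t. F (p t)) \<in> measurable (lebesgue_on S) (count_space UNIV)"
      using measurable_comp[OF fl measurable_count_space] by simp
    have "{x \<in> space (lebesgue_on S). x \<in> {a..b}} = {a..b}"
      using sub by auto
    moreover have "{a..b} \<in> sets (lebesgue_on S)"
      using S sub by (subst sets_restrict_space_iff) auto
    ultimately have "{x \<in> space (lebesgue_on S). x \<in> {a..b}} \<in> sets (lebesgue_on S)"
      by (simp only:)
    then have sm: "s \<in> measurable (lebesgue_on S) (count_space UNIV)"
      unfolding s_def by (intro measurable_If[OF Fp measurable_const]) auto
    have "s t \<in> insert 0 ((\<lambda>k. F (max a (real_of_int k / real N))) ` {\<lfloor>real N * a\<rfloor>..\<lfloor>real N * b\<rfloor>})" for t
    proof (cases "t \<in> {a..b}")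
      case True
      then have "\<lfloor>real N * t\<rfloor> \<in> {\<lfloor>real N * a\<rfloor>..\<lfloor>real N * b\<rfloor>}"
        by (simp add: floor_mono mult_left_mono)
      with True show ?thesis unfolding s_def p_def by (simp only: if_True) (intro insertI2 imageI)
    next
      case False
      then show ?thesis unfolding s_def by (simp only: if_False insertI1)
    qed
    then have "s ` S \<subseteq> insert 0 ((\<lambda>k. F (max a (real_of_int k / real N))) ` {\<lfloor>real N * a\<rfloor>..\<lfloor>real N * b\<rfloor>})"
      by (rule image_subsetI)
    then have fin: "finite (s ` S)"
      by (rule finite_subset) simp
    have "s -` {x} \<inter> space (lebesgue_on S) \<in> sets (lebesgue_on S)" for x
      using sm by (rule measurable_sets) simp
    then have sf: "simple_function (lebesgue_on S) s"
      using fin by (simp add: simple_function_def)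
    have m: "{y \<in> space (lebesgue_on S). s y \<noteq> 0} \<in> sets (lebesgue_on S)"
    proof -
      have "s -` (UNIV - {0}) \<inter> space (lebesgue_on S) \<in> sets (lebesgue_on S)"
        using sm by (rule measurable_sets) simp
      then show ?thesis by (simp add: vimage_def Int_def conj_commute)
    qed
    have "emeasure (lebesgue_on S) {y \<in> space (lebesgue_on S). s y \<noteq> 0} \<le> emeasure (lebesgue_on S) {a..b}"
      using sub S by (intro emeasure_mono) (auto simp: s_def sets_restrict_space_iff split: if_splits)
    also have "\<dots> = emeasure lebesgue {a..b}"
      using sub S by (intro emeasure_restrict_space) auto
    also have "\<dots> < \<infinity>" by (simp add: emeasure_lborel_Icc_eq)
    finally have "Bochner_Integration.simple_bochner_integrable (lebesgue_on S) s"
      using sf by (auto intro: simple_bochner_integrable.intros)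
    moreover have "norm (F t - s t) \<le> e" if "t \<in> {a..b}" for t
      using d(2)[OF that p(1)[OF that] p(2)[OF that]] that by (simp add: s_def dist_norm norm_minus_commute)
    moreover have "\<forall>t. t \<notin> {a..b} \<longrightarrow> s t = 0" by (simp add: s_def)
    ultimately show ?thesis by blast
  qed
  have "\<exists>s. Bochner_Integration.simple_bochner_integrable (lebesgue_on S) s \<and>
      (\<forall>t\<in>{a..b}. norm (F t - s t) \<le> inverse (real (Suc n))) \<and> (\<forall>t. t \<notin> {a..b} \<longrightarrow> s t = 0)" for n
    by (rule ex) simp
  then obtain s where s: "\<And>n. Bochner_Integration.simple_bochner_integrable (lebesgue_on S) (s n)"
    and near: "\<And>n t. t \<in> {a..b} \<Longrightarrow> norm (F t - s n t) \<le> inverse (real (Suc n))"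
    and out: "\<And>n t. t \<notin> {a..b} \<Longrightarrow> s n t = 0"
    by metis
  define c where "c = max 0 (b - a)"
  have lim: "(\<lambda>n. inverse (real (Suc n)) * c) \<longlonglongrightarrow> 0"
    using tendsto_mult_left_zero[OF LIMSEQ_inverse_real_of_nat] by simp
  have "(\<integral>\<^sup>+t. norm (F t - s n t) \<partial>lebesgue_on S) \<le> ennreal (inverse (real (Suc n)) * c)" for n
  proof -
    have "(\<integral>\<^sup>+t. norm (F t - s n t) \<partial>lebesgue_on S) \<le>
        (\<integral>\<^sup>+t. ennreal (inverse (real (Suc n))) * indicator {a..b} t \<partial>lebesgue_on S)"
    proof (rule nn_integral_mono)
      fix t assume "t \<in> space (lebesgue_on S)"
      then show "ennreal (norm (F t - s n t)) \<le> ennreal (inverse (real (Suc n))) * indicator {a..b} t"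
        using near[of t n] 0[of t] out[of t n] by (auto simp: indicator_def simp del: of_nat_Suc intro: ennreal_leI)
    qed
    also have "\<dots> = ennreal (inverse (real (Suc n))) * emeasure (lebesgue_on S) {a..b}"
      using sub S by (intro nn_integral_cmult_indicator) (auto simp: sets_restrict_space_iff)
    also have "emeasure (lebesgue_on S) {a..b} = emeasure lebesgue {a..b}"
      using sub S by (intro emeasure_restrict_space) auto
    also have "\<dots> = ennreal c"
      by (auto simp: c_def emeasure_lborel_Icc_eq max_def)
    finally show ?thesis by (simp add: ennreal_mult' c_def)
  qed
  note le = this
  have "(\<lambda>n. ennreal (inverse (real (Suc n)) * c)) \<longlonglongrightarrow> 0"
    using tendsto_ennrealI[OF lim] by (simp only: ennreal_0)
  then have L1: "(\<lambda>n. \<integral>\<^sup>+t. norm (F t - s n t) \<partial>lebesgue_on S) \<longlonglongrightarrow> 0"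
    by (rule tendsto_sandwich[OF always_eventually always_eventually tendsto_const, rotated 2])
      (use le in \<open>simp_all del: of_nat_Suc\<close>)
  have "norm (integral {a..b} F - Bochner_Integration.simple_bochner_integral (lebesgue_on S) (s n))
      \<le> inverse (real (Suc n)) * c" for n
  proof (cases "a \<le> b")
    case True
    have "((\<lambda>t. F t - s n t) has_integral
        (integral {a..b} F - Bochner_Integration.simple_bochner_integral (lebesgue_on S) (s n))) {a..b}"
      using Fint by (intro has_integral_diff simple_bochner_integral_eq_integral[OF S s sub] integrable_integral out) auto
    from has_integral_bound_real[OF _ finite.emptyI this, of "inverse (real (Suc n))"] near True
    show ?thesis by (simp add: c_def del: of_nat_Suc)
  next
    case False
    have "(s n has_integral Bochner_Integration.simple_bochner_integral (lebesgue_on S) (s n)) {a..b}"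
      by (intro simple_bochner_integral_eq_integral[OF S s sub] out) auto
    moreover have "{a..b} = {}" using False by simp
    ultimately have "Bochner_Integration.simple_bochner_integral (lebesgue_on S) (s n) = 0"
      by (simp only: has_integral_empty_eq)
    then show ?thesis using False by (simp add: c_def del: of_nat_Suc)
  qed
  then have "(\<lambda>n. integral {a..b} F - Bochner_Integration.simple_bochner_integral (lebesgue_on S) (s n)) \<longlonglongrightarrow> 0"
    by (intro Lim_null_comparison[OF _ lim] always_eventually) auto
  from tendsto_diff[OF tendsto_const[of "integral {a..b} F"] this]
  have "(\<lambda>n. Bochner_Integration.simple_bochner_integral (lebesgue_on S) (s n)) \<longlonglongrightarrow> integral {a..b} F"
    by simp
  with L1 s continuous_imp_measurable_on_sets_lebesgue[OF F S] show ?thesis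
    unfolding bochner_has_integral_def by blast
qed

section \<open>Smooth functions and difference quotients\<close>

definition diff_quot :: "real \<Rightarrow> (real \<Rightarrow> 'a::real_vector) \<Rightarrow> real \<Rightarrow> 'a" where
  "diff_quot h g t = (1 / h) *\<^sub>R (g (t + h) - g t)"

definition derivative_chain :: "(nat \<Rightarrow> real \<Rightarrow> 'a::real_normed_vector) \<Rightarrow> bool" where
  "derivative_chain F \<longleftrightarrow> (\<forall>k t. (F k has_vector_derivative F (Suc k) t) (at t))"

inductive_set function_algebra :: "(real \<Rightarrow> real) set \<Rightarrow> (real \<Rightarrow> real) set" for B where
  gen: "f \<in> B \<Longrightarrow> f \<in> function_algebra B"
| const: "(\<lambda>_. c) \<in> function_algebra B"
| add: "f \<in> function_algebra B \<Longrightarrow> g \<in> function_algebra B \<Longrightarrow> (\<lambda>t. f t + g t) \<in> function_algebra B"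
| mult: "f \<in> function_algebra B \<Longrightarrow> g \<in> function_algebra B \<Longrightarrow> (\<lambda>t. f t * g t) \<in> function_algebra B"

text \<open>
  A class of functions that contains a derivative of each of its members consists of smooth
  functions. To get such a class it suffices, by the sum and product rules, to have the
  derivatives of generators in the algebra that they generate. This replaces closed formulas
  for higher derivatives.
\<close>
lemma function_algebra_derivative:
  assumes B: "\<And>f. f \<in> B \<Longrightarrow> \<exists>g\<in>function_algebra B. \<forall>t. (f has_real_derivative g t) (at t)"
    and f: "f \<in> function_algebra B"
  shows "\<exists>g\<in>function_algebra B. \<forall>t. (f has_real_derivative g t) (at t)"
  using f
proof induction
  case (const c)
  then show ?case by (intro bexI[of _ "\<lambda>_. 0"] function_algebra.const) simp
next
  case (add f g)
  then obtain f' g' where "f' \<in> function_algebra B" "g' \<in> function_algebra B"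
    "\<forall>t. (f has_real_derivative f' t) (at t)" "\<forall>t. (g has_real_derivative g' t) (at t)" by blast
  then show ?case
    by (intro bexI[of _ "\<lambda>t. f' t + g' t"] function_algebra.add) (auto intro: DERIV_add)
next
  case (mult f g)
  then obtain f' g' where "f' \<in> function_algebra B" "g' \<in> function_algebra B"
    "\<forall>t. (f has_real_derivative f' t) (at t)" "\<forall>t. (g has_real_derivative g' t) (at t)" by blast
  with mult show ?case
    by (intro bexI[of _ "\<lambda>t. f' t * g t + g' t * f t"] function_algebra.add function_algebra.mult)
      (auto intro: DERIV_mult)
qed (use B in blast)

lemma derivative_chain_function_algebra:
  assumes B: "\<And>f. f \<in> B \<Longrightarrow> \<exists>g\<in>function_algebra B. \<forall>t. (f has_real_derivative g t) (at t)"
    and f: "f \<in> function_algebra B"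
  shows "\<exists>F. F 0 = f \<and> derivative_chain F"
proof -
  have "\<exists>F. \<forall>k. (F k \<in> function_algebra B \<and> (k = 0 \<longrightarrow> F k = f)) \<and>
      (\<forall>t. (F k has_real_derivative F (Suc k) t) (at t))"
    using function_algebra_derivative[OF B] f
    by (intro dependent_nat_choice) blast+
  then obtain F where "\<And>k. (k = 0 \<longrightarrow> F k = f)" "\<And>k t. (F k has_real_derivative F (Suc k) t) (at t)"
    by blast
  then show ?thesis
    unfolding derivative_chain_def has_real_derivative_iff_has_vector_derivative by blast
qed

section \<open>An almost periodic function whose derivative is not uniformly continuous\<close>

definition trig_sum :: "real \<Rightarrow> real" where
  "trig_sum t = 2 + cos t + cos (sqrt 2 * t)"

text \<open>
  At a zero both cosines are \<open>-1\<close>, so \<open>\<surd>2\<close> is a quotient of two odd integers; squaring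
  contradicts parity.
\<close>
lemma trig_sum_pos: "trig_sum t > 0"
proof (rule ccontr)
  assume "\<not> trig_sum t > 0"
  moreover have "cos t \<ge> -1" "cos (sqrt 2 * t) \<ge> -1" by auto
  ultimately have "cos t = -1" "cos (sqrt 2 * t) = -1" unfolding trig_sum_def by linarith+
  then obtain m n where m: "t = (2 * real_of_int m + 1) * pi" and n: "sqrt 2 * t = (2 * real_of_int n + 1) * pi"
    by (auto simp: cos_eq_minus1)
  then have "sqrt 2 * (2 * real_of_int m + 1) = 2 * real_of_int n + 1" by simp
  then have "(sqrt 2 * (2 * real_of_int m + 1))\<^sup>2 = (2 * real_of_int n + 1)\<^sup>2" by simp
  then have "2 * (2 * real_of_int m + 1)\<^sup>2 = (2 * real_of_int n + 1)\<^sup>2" by (simp add: power_mult_distrib)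
  then have "real_of_int (2 * (2 * m + 1)\<^sup>2) = real_of_int ((2 * n + 1)\<^sup>2)" by simp
  then have "2 * (2 * m + 1)\<^sup>2 = (2 * n + 1)\<^sup>2" by linarith
  moreover have "odd ((2 * n + 1)\<^sup>2)" by simp
  ultimately show False by (metis dvd_triv_left)
qed

lemma trig_sum_le: "trig_sum t \<le> 4"
  unfolding trig_sum_def using cos_le_one[of t] cos_le_one[of "sqrt 2 * t"] by linarith

lemma derivative_chain_trig_sum_powr: "\<exists>F. F 0 = (\<lambda>t. trig_sum t powr a) \<and> derivative_chain F"
proof -
  define B where "B = range (\<lambda>\<omega> t. cos (\<omega> * t)) \<union> range (\<lambda>\<omega> t. sin (\<omega> * t)) \<union> range (\<lambda>b t. trig_sum t powr b)"
  have B: "(\<lambda>t. cos (\<omega> * t)) \<in> function_algebra B" "(\<lambda>t. sin (\<omega> * t)) \<in> function_algebra B"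
    "(\<lambda>t. trig_sum t powr b) \<in> function_algebra B" for \<omega> b
    by (auto simp: B_def intro: function_algebra.gen)
  show ?thesis
  proof (rule derivative_chain_function_algebra[of B])
    show "(\<lambda>t. trig_sum t powr a) \<in> function_algebra B" by (rule B)
    fix f assume "f \<in> B"
    then consider \<omega> where "f = (\<lambda>t. cos (\<omega> * t))" | \<omega> where "f = (\<lambda>t. sin (\<omega> * t))"
      | b where "f = (\<lambda>t. trig_sum t powr b)" by (auto simp: B_def)
    then show "\<exists>g\<in>function_algebra B. \<forall>t. (f has_real_derivative g t) (at t)"
    proof cases
      case (1 \<omega>)
      then show ?thesis
        by (intro bexI[of _ "\<lambda>t. (- \<omega>) * sin (\<omega> * t)"] function_algebra.mult function_algebra.const B)
          (auto intro!: derivative_eq_intros)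
    next
      case (2 \<omega>)
      then show ?thesis
        by (intro bexI[of _ "\<lambda>t. \<omega> * cos (\<omega> * t)"] function_algebra.mult function_algebra.const B)
          (auto intro!: derivative_eq_intros)
    next
      case (3 b)
      have d: "(trig_sum has_real_derivative (-1) * sin (1 * t) + (- sqrt 2) * sin (sqrt 2 * t)) (at t)" for t
        unfolding trig_sum_def by (auto intro!: derivative_eq_intros)
      have "((\<lambda>t. trig_sum t powr b) has_real_derivative
          (b * trig_sum t powr (b - 1)) * ((-1) * sin (1 * t) + (- sqrt 2) * sin (sqrt 2 * t))) (at t)" for t
        using DERIV_fun_powr[OF d trig_sum_pos, of b t] by simp
      with 3 show ?thesis
        by (intro bexI[of _ "\<lambda>t. (b * trig_sum t powr (b - 1)) * ((-1) * sin (1 * t) + (- sqrt 2) * sin (sqrt 2 * t))"]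
            function_algebra.mult function_algebra.add function_algebra.const B) auto
    qed
  qed
qed

text \<open>
  These are convergents \<open>q / r\<close> of \<open>\<surd>2\<close> with \<open>q\<^sup>2 - 2 r\<^sup>2 = -1\<close>; multiplying
  \<open>q + r \<surd>2\<close> by the unit \<open>3 + 2 \<surd>2\<close> gives the next one and preserves the parities.
\<close>
lemma pell_odd_solutions:
  "\<exists>r q :: nat. odd r \<and> odd q \<and> q\<^sup>2 + 1 = 2 * r\<^sup>2 \<and> r > k"
proof (induction k)
  case 0
  show ?case by (intro exI[of _ 1]) auto
next
  case (Suc k)
  then obtain r q where "odd r" "odd q" "q\<^sup>2 + 1 = 2 * r\<^sup>2" "r > k" by blast
  then show ?case
    by (intro exI[of _ "3 * r + 2 * q"] exI[of _ "4 * r + 3 * q"]) (auto simp: power2_eq_square algebra_simps)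
qed

lemma cos_odd_multiple_pi_add: "odd n \<Longrightarrow> cos (real n * pi + x) = - cos x"
  by (simp add: cos_add)

text \<open>
  Take \<open>\<tau> = r \<pi>\<close> with a solution \<open>(r, q)\<close> of the Pell equation: as \<open>r\<close> is odd, the first
  cosine changes sign, and as \<open>\<surd>2 r\<close> is within \<open>1 / (\<surd>2 r + q)\<close> of the odd number \<open>q\<close>,
  the second one does so in the limit.
\<close>
lemma trig_sum_recurrence:
  obtains \<tau> :: "nat \<Rightarrow> real" where "\<And>k. \<tau> k \<ge> real k"
    and "\<And>x. (\<lambda>k. trig_sum (\<tau> k + x)) \<longlonglongrightarrow> 2 - cos x - cos (sqrt 2 * x)"
proof -
  from pell_odd_solutions obtain r q :: "nat \<Rightarrow> nat"
    where r: "\<And>k. odd (r k)" and q: "\<And>k. odd (q k)" and pell: "\<And>k. (q k)\<^sup>2 + 1 = 2 * (r k)\<^sup>2" and gt: "\<And>k. r k > k"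
    by metis
  define \<epsilon> where "\<epsilon> k = sqrt 2 * real (r k) - real (q k)" for k
  have "norm (\<epsilon> k) \<le> inverse (real (Suc k))" for k
  proof -
    have "\<epsilon> k * (sqrt 2 * real (r k) + real (q k)) = 2 * (real (r k))\<^sup>2 - (real (q k))\<^sup>2"
      by (simp add: \<epsilon>_def algebra_simps power2_eq_square)
    also have "\<dots> = 1"
      using arg_cong[OF pell[of k], of real] by simp
    finally have eq: "\<epsilon> k * (sqrt 2 * real (r k) + real (q k)) = 1" .
    have "real (Suc k) \<le> real (r k)" using gt[of k] by linarith
    also have "\<dots> \<le> sqrt 2 * real (r k) + real (q k)"
      using mult_right_mono[of 1 "sqrt 2" "real (r k)"] by simp
    finally have "inverse (sqrt 2 * real (r k) + real (q k)) \<le> inverse (real (Suc k))"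
      by (intro le_imp_inverse_le) auto
    moreover have "\<epsilon> k = inverse (sqrt 2 * real (r k) + real (q k))"
      using eq by (metis inverse_unique mult.commute)
    ultimately show ?thesis by simp
  qed
  then have lim: "\<epsilon> \<longlonglongrightarrow> 0"
    by (intro Lim_null_comparison[OF _ LIMSEQ_inverse_real_of_nat] always_eventually) auto
  show ?thesis
  proof (rule that[of "\<lambda>k. real (r k) * pi"])
    show "real k \<le> real (r k) * pi" for k
      using gt[of k] pi_gt3 mult_left_mono[of 1 pi "real (r k)"] by linarith
    fix x
    have "trig_sum (real (r k) * pi + x) = 2 - cos x - cos (sqrt 2 * x + pi * \<epsilon> k)" for k
    proof -
      have "sqrt 2 * (real (r k) * pi + x) = real (q k) * pi + (sqrt 2 * x + pi * \<epsilon> k)"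
        by (simp add: \<epsilon>_def algebra_simps)
      then show ?thesis
        unfolding trig_sum_def using cos_odd_multiple_pi_add[OF r] cos_odd_multiple_pi_add[OF q] by simp
    qed
    moreover have "(\<lambda>k. 2 - cos x - cos (sqrt 2 * x + pi * \<epsilon> k)) \<longlonglongrightarrow> 2 - cos x - cos (sqrt 2 * x + pi * 0)"
      by (intro tendsto_intros lim)
    ultimately show "(\<lambda>k. trig_sum (real (r k) * pi + x)) \<longlonglongrightarrow> 2 - cos x - cos (sqrt 2 * x)"
      by simp
  qed
qed

definition right_lipschitz_0 :: "(real \<Rightarrow> real) \<Rightarrow> bool" where
  "right_lipschitz_0 \<psi> \<longleftrightarrow> (\<exists>L. \<forall>\<^sub>F x in at_right 0. \<bar>\<psi> x - \<psi> 0\<bar> \<le> L * x)"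

lemma eventually_lipschitz_if_differentiable:
  fixes \<psi> :: "real \<Rightarrow> real"
  assumes "\<psi> differentiable (at c)"
  shows "\<exists>L. \<forall>\<^sub>F x in at_right 0. \<bar>\<psi> (c + x) - \<psi> c\<bar> \<le> L * x"
proof -
  from assms obtain D where "(\<psi> has_real_derivative D) (at c)"
    using real_differentiable_def by blast
  then have "((\<lambda>x. (\<psi> (c + x) - \<psi> c) / x) \<longlongrightarrow> D) (at_right 0)"
    unfolding DERIV_def by (rule tendsto_mono[rotated]) (simp add: at_le)
  then have "\<forall>\<^sub>F x in at_right 0. \<bar>(\<psi> (c + x) - \<psi> c) / x\<bar> < \<bar>D\<bar> + 1"
    by (intro order_tendstoD(2)[OF tendsto_rabs]) auto
  moreover have "\<forall>\<^sub>F x in at_right (0::real). x > 0"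
    by (simp add: eventually_at_right_less)
  ultimately have "\<forall>\<^sub>F x in at_right 0. \<bar>\<psi> (c + x) - \<psi> c\<bar> \<le> (\<bar>D\<bar> + 1) * x"
    by eventually_elim (simp add: field_simps)
  then show ?thesis by blast
qed

text \<open>
  For \<open>n = 1\<close>: \<open>\<psi>(x) = \<psi>(x + h) - h D\<^sub>h \<psi>(x)\<close>, and the first term is Lipschitz
  near \<open>0\<close> because \<open>\<psi>\<close> is differentiable at \<open>h\<close>. Each further difference quotient moves the
  points at which differentiability matters by one more step \<open>h\<close>.
\<close>
lemma right_lipschitz_0_of_diff_quot:
  assumes "h > 0" and "\<And>x. 0 < x \<Longrightarrow> x \<le> real n * h \<Longrightarrow> \<psi> differentiable (at x)"
    and "right_lipschitz_0 ((diff_quot h ^^ n) \<psi>)"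
  shows "right_lipschitz_0 \<psi>"
  using assms(2,3)
proof (induction n arbitrary: \<psi>)
  case (Suc n)
  have "right_lipschitz_0 (diff_quot h \<psi>)"
  proof (rule Suc.IH)
    show "right_lipschitz_0 ((diff_quot h ^^ n) (diff_quot h \<psi>))"
      using Suc.prems(2) by (simp add: funpow_swap1)
    fix x assume x: "0 < x" "x \<le> real n * h"
    then have 1: "\<psi> differentiable (at x)" and 2: "\<psi> differentiable (at (x + h))"
      using \<open>h > 0\<close> by (auto intro!: Suc.prems(1) simp: algebra_simps)
    from 2 have "(\<lambda>y. \<psi> (y + h)) differentiable (at x)"
      using differentiable_chain_at[of "\<lambda>y. y + h" x \<psi>] by (simp add: o_def)
    with 1 show "diff_quot h \<psi> differentiable (at x)"
      unfolding diff_quot_def real_scaleR_def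
      by (intro differentiable_mult differentiable_const differentiable_diff)
  qed
  then obtain L where L: "\<forall>\<^sub>F x in at_right 0. \<bar>diff_quot h \<psi> x - diff_quot h \<psi> 0\<bar> \<le> L * x"
    unfolding right_lipschitz_0_def by blast
  have "\<psi> differentiable (at h)"
    using \<open>h > 0\<close> by (intro Suc.prems(1)) (auto simp: algebra_simps)
  from eventually_lipschitz_if_differentiable[OF this]
  obtain L' where "\<forall>\<^sub>F x in at_right 0. \<bar>\<psi> (h + x) - \<psi> h\<bar> \<le> L' * x" by blast
  with L have "\<forall>\<^sub>F x in at_right 0. \<bar>\<psi> x - \<psi> 0\<bar> \<le> (L' + h * L) * x"
  proof eventually_elim
    case (elim x)
    have "\<psi> x - \<psi> 0 = (\<psi> (h + x) - \<psi> h) - h * (diff_quot h \<psi> x - diff_quot h \<psi> 0)"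
      using \<open>h > 0\<close> by (simp add: diff_quot_def field_simps)
    also have "\<bar>\<dots>\<bar> \<le> \<bar>\<psi> (h + x) - \<psi> h\<bar> + h * \<bar>diff_quot h \<psi> x - diff_quot h \<psi> 0\<bar>"
      using \<open>h > 0\<close> by (metis abs_mult abs_of_pos abs_triangle_ineq4)
    also have "\<dots> \<le> L' * x + h * (L * x)"
      using elim \<open>h > 0\<close> by (intro add_mono mult_left_mono) auto
    finally show ?case by (simp add: algebra_simps)
  qed
  then show ?case unfolding right_lipschitz_0_def by blast
qed simp

text \<open>
  Over a fixed step \<open>e\<close> the derivative varies by less than \<open>1\<close>, while its mean value over
  the step is at most \<open>2 C / e\<close>; so the derivative is bounded.
\<close>
lemma lipschitz_if_bounded_and_uniformly_continuous_derivative: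
  fixes g :: "real \<Rightarrow> real"
  assumes der: "\<And>t. (g has_real_derivative g' t) (at t)"
    and bd: "\<And>t. \<bar>g t\<bar> \<le> C" and uc: "uniformly_continuous_on {a..} g'"
  shows "\<exists>L. \<forall>s\<ge>a. \<forall>t\<ge>a. \<bar>g s - g t\<bar> \<le> L * \<bar>s - t\<bar>"
proof -
  obtain d where d: "d > 0" "\<And>s t. s \<ge> a \<Longrightarrow> t \<ge> a \<Longrightarrow> dist s t < d \<Longrightarrow> dist (g' s) (g' t) < 1"
    using uc unfolding uniformly_continuous_on_def by (metis atLeast_iff zero_less_one)
  define e where "e = d / 2"
  have e: "0 < e" "e < d" using d(1) by (auto simp: e_def)
  have bd': "\<bar>g' t\<bar> \<le> 1 + 2 * C / e" if "t \<ge> a" for t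
  proof -
    obtain z where z: "t < z" "z < t + e" "g (t + e) - g t = (t + e - t) * g' z"
      using MVT2[of t "t + e" g g'] der e by auto
    have "dist (g' t) (g' z) < 1" using that z e by (intro d(2)) (auto simp: dist_real_def)
    moreover have "\<bar>g' z\<bar> \<le> 2 * C / e"
    proof -
      have "e * \<bar>g' z\<bar> = \<bar>g (t + e) - g t\<bar>" using z e by (simp add: abs_mult)
      also have "\<dots> \<le> 2 * C" using bd[of "t + e"] bd[of t] by linarith
      finally show ?thesis using e by (simp add: field_simps)
    qed
    ultimately show ?thesis by (auto simp: dist_real_def)
  qed
  have lt: "\<bar>g s - g t\<bar> \<le> (1 + 2 * C / e) * \<bar>s - t\<bar>" if st: "a \<le> s" "s < t" for s t
  proof -
    obtain z where z: "s < z" "z < t" "g t - g s = (t - s) * g' z"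
      using MVT2[of s t g g'] der st by auto
    then have "\<bar>g s - g t\<bar> = \<bar>g' z\<bar> * \<bar>s - t\<bar>" by (metis abs_minus_commute abs_mult mult.commute)
    also have "\<dots> \<le> (1 + 2 * C / e) * \<bar>s - t\<bar>"
      using z st by (intro mult_right_mono bd') auto
    finally show ?thesis .
  qed
  show ?thesis
  proof (intro exI allI impI)
    fix s t assume "a \<le> s" "a \<le> t"
    then show "\<bar>g s - g t\<bar> \<le> (1 + 2 * C / e) * \<bar>s - t\<bar>"
      using lt[of s t] lt[of t s] by (cases s t rule: linorder_cases) (auto simp: abs_minus_commute)
  qed
qed

lemma funpow_diff_quot_has_vector_derivative:
  assumes "\<And>t. (g has_vector_derivative g' t) (at t)"
  shows "((diff_quot h ^^ n) g has_vector_derivative (diff_quot h ^^ n) g' t) (at t)"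
proof (induction n arbitrary: t)
  case (Suc n)
  have "((\<lambda>s. (diff_quot h ^^ n) g (s + h)) has_vector_derivative (diff_quot h ^^ n) g' (t + h)) (at t)"
    using vector_diff_chain_at[of "\<lambda>s. s + h" 1 t "(diff_quot h ^^ n) g", OF _ Suc[of "t + h"]]
    by (simp add: o_def has_vector_derivative_add_const)
  then show ?case using Suc[of t] unfolding funpow.simps o_def diff_quot_def
    by (intro derivative_intros bounded_linear.has_vector_derivative[OF bounded_linear_scaleR_right])
qed (use assms in simp)

lemma funpow_diff_quot_bounded:
  fixes g :: "real \<Rightarrow> real"
  assumes "\<And>t. \<bar>g t\<bar> \<le> C"
  shows "\<exists>C. \<forall>t. \<bar>(diff_quot h ^^ n) g t\<bar> \<le> C"
proof (induction n)
  case (Suc n)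
  then obtain C where C: "\<And>t. \<bar>(diff_quot h ^^ n) g t\<bar> \<le> C" by blast
  have "\<bar>diff_quot h ((diff_quot h ^^ n) g) t\<bar> \<le> \<bar>1 / h\<bar> * (2 * C)" for t
    unfolding diff_quot_def[of h "(diff_quot h ^^ n) g"] real_scaleR_def abs_mult
    using C[of "t + h"] C[of t] by (intro mult_left_mono) linarith+
  then show ?case by auto
qed (use assms in auto)

lemma tendsto_funpow_diff_quot:
  fixes g :: "real \<Rightarrow> 'a::real_normed_vector"
  assumes "\<And>x. (\<lambda>k. g (\<tau> k + x)) \<longlonglongrightarrow> \<phi> x"
  shows "(\<lambda>k. (diff_quot h ^^ n) g (\<tau> k + x)) \<longlonglongrightarrow> (diff_quot h ^^ n) \<phi> x"
proof (induction n arbitrary: x)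
  case (Suc n)
  have "(\<lambda>k. (diff_quot h ^^ n) g (\<tau> k + (x + h))) \<longlonglongrightarrow> (diff_quot h ^^ n) \<phi> (x + h)" by (rule Suc)
  then show ?case using Suc[of x] unfolding funpow.simps o_def diff_quot_def
    by (intro tendsto_intros) (simp_all add: add.assoc)
qed (use assms in simp)

text \<open>
  The function under the root is at least \<open>1 - cos x\<close>, which is of order \<open>x\<^sup>2\<close>, whereas a
  Lipschitz bound for the fourth root would force order \<open>x\<^sup>4\<close>.
\<close>
lemma fourth_root_not_right_lipschitz:
  "\<not> right_lipschitz_0 (\<lambda>x. (2 - cos x - cos (sqrt 2 * x)) powr (1/4))"
proof
  assume "right_lipschitz_0 (\<lambda>x. (2 - cos x - cos (sqrt 2 * x)) powr (1/4))"
  then obtain L where L: "\<forall>\<^sub>F x in at_right 0. (2 - cos x - cos (sqrt 2 * x)) powr (1/4) \<le> L * x"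
    unfolding right_lipschitz_0_def by auto
  have "filterlim (\<lambda>x::real. (1 - cos x) / x ^ 4) at_top (at_right 0)" by real_asymp
  then have "\<forall>\<^sub>F x in at_right 0. (1 - cos x) / x ^ 4 > L ^ 4"
    by (simp add: filterlim_at_top_dense)
  moreover have "\<forall>\<^sub>F x in at_right (0::real). x > 0"
    by (simp add: eventually_at_right_less)
  ultimately have "\<forall>\<^sub>F x in at_right (0::real). False"
    using L
  proof eventually_elim
    case (elim x)
    let ?v = "2 - cos x - cos (sqrt 2 * x)"
    have v: "?v \<ge> 1 - cos x" "1 - cos x \<ge> 0" using cos_le_one[of "sqrt 2 * x"] cos_le_one[of x] by linarith+
    have "?v = (?v powr (1/4)) ^ 4"
    proof (cases "?v = 0")
      case False
      then have "?v > 0" using v by linarith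
      then show ?thesis by (simp add: powr_power)
    qed simp
    also have "\<dots> \<le> (L * x) ^ 4" using elim by (intro power_mono) auto
    finally have "1 - cos x \<le> L ^ 4 * x ^ 4" using v(1) unfolding power_mult_distrib by linarith
    with elim show False by (simp add: field_simps)
  qed
  then show False by simp
qed

text \<open>
  The translates of \<open>F 0\<close> by \<open>\<tau> k\<close> converge pointwise to \<open>\<phi>\<close>, and a Lipschitz bound for
  the iterated difference quotient on a half-line passes to the limit.
\<close>
lemma diff_quot_derivative_not_uniformly_continuous:
  assumes F: "derivative_chain F" and F0: "F 0 = (\<lambda>t. trig_sum t powr (1/4))"
  shows "\<not> uniformly_continuous_on {a..} ((diff_quot (1 / real (Suc n)) ^^ n) (F 1))"
proof
  \<comment> \<open>Any step with \<open>n h < 2 \<pi>\<close> keeps the points \<open>h, \<dots>, n h\<close> away from the zeros of \<open>1 - cos\<close>.\<close>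
  define h where "h = 1 / real (Suc n)"
  have h: "h > 0" "real n * h < 1" by (auto simp: h_def field_simps)
  let ?g = "(diff_quot h ^^ n) (F 0)"
  define \<phi> where "\<phi> x = (2 - cos x - cos (sqrt 2 * x)) powr (1/4)" for x :: real
  assume "uniformly_continuous_on {a..} ((diff_quot (1 / real (Suc n)) ^^ n) (F 1))"
  then have uc: "uniformly_continuous_on {a..} ((diff_quot h ^^ n) (F 1))" by (simp only: h_def)
  have "\<bar>F 0 t\<bar> \<le> 4 powr (1/4)" for t
    unfolding F0 using trig_sum_pos[of t] trig_sum_le[of t] by (simp add: powr_mono2)
  from funpow_diff_quot_bounded[of "F 0", OF this] obtain C where C: "\<And>t. \<bar>?g t\<bar> \<le> C" by blast
  have "(?g has_real_derivative (diff_quot h ^^ n) (F 1) t) (at t)" for t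
    unfolding has_real_derivative_iff_has_vector_derivative
    using F by (intro funpow_diff_quot_has_vector_derivative) (auto simp: derivative_chain_def)
  from lipschitz_if_bounded_and_uniformly_continuous_derivative[OF this C uc]
  obtain L where L: "\<And>s t. s \<ge> a \<Longrightarrow> t \<ge> a \<Longrightarrow> \<bar>?g s - ?g t\<bar> \<le> L * \<bar>s - t\<bar>" by blast
  obtain \<tau> where \<tau>: "\<And>k. \<tau> k \<ge> real k" and lim: "\<And>x. (\<lambda>k. trig_sum (\<tau> k + x)) \<longlonglongrightarrow> 2 - cos x - cos (sqrt 2 * x)"
    using trig_sum_recurrence by blast
  have lim': "(\<lambda>k. F 0 (\<tau> k + x)) \<longlonglongrightarrow> \<phi> x" for x
    unfolding F0 \<phi>_def
    by (rule tendsto_powr'[OF lim tendsto_const]) (auto intro!: always_eventually less_imp_le trig_sum_pos)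
  have lip: "\<bar>(diff_quot h ^^ n) \<phi> x - (diff_quot h ^^ n) \<phi> 0\<bar> \<le> L * x" if "x > 0" for x
  proof (rule tendsto_upperbound)
    show "(\<lambda>k. \<bar>?g (\<tau> k + x) - ?g (\<tau> k + 0)\<bar>) \<longlonglongrightarrow> \<bar>(diff_quot h ^^ n) \<phi> x - (diff_quot h ^^ n) \<phi> 0\<bar>"
      by (intro tendsto_intros tendsto_funpow_diff_quot lim')
    have "\<forall>\<^sub>F k in sequentially. real k \<ge> a"
      using filterlim_real_sequentially by (simp add: filterlim_at_top)
    then show "\<forall>\<^sub>F k in sequentially. \<bar>?g (\<tau> k + x) - ?g (\<tau> k + 0)\<bar> \<le> L * x"
    proof eventually_elim
      case (elim k)
      then show ?case using L[of "\<tau> k + x" "\<tau> k + 0"] \<tau>[of k] that by simp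
    qed
  qed simp
  have "\<forall>\<^sub>F x in at_right (0::real). x > 0"
    by (simp add: eventually_at_right_less)
  then have "\<forall>\<^sub>F x in at_right 0. \<bar>(diff_quot h ^^ n) \<phi> x - (diff_quot h ^^ n) \<phi> 0\<bar> \<le> L * x"
    by eventually_elim (rule lip)
  then have dq: "right_lipschitz_0 ((diff_quot h ^^ n) \<phi>)"
    unfolding right_lipschitz_0_def by blast
  have diff: "\<phi> differentiable (at x)" if "0 < x" "x \<le> real n * h" for x
  proof -
    have "x < 1" using that h by linarith
    then have "cos x < 1" using cos_monotone_0_pi[of 0 x] that pi_gt3 by simp
    then have pos: "2 - cos x - cos (sqrt 2 * x) > 0" using cos_le_one[of "sqrt 2 * x"] by linarith
    have "((\<lambda>x. 2 - cos x - cos (sqrt 2 * x)) has_real_derivative (sin x + sqrt 2 * sin (sqrt 2 * x))) (at x)"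
      by (auto intro!: derivative_eq_intros)
    from DERIV_fun_powr[OF this pos, of "1/4"] show ?thesis
      unfolding \<phi>_def real_differentiable_def by auto
  qed
  have "right_lipschitz_0 \<phi>"
    by (rule right_lipschitz_0_of_diff_quot[OF h(1) diff dq])
  then show False using fourth_root_not_right_lipschitz unfolding \<phi>_def by blast
qed

section \<open>Almost periodicity\<close>

lemma trig_polys_real_zero: "(\<lambda>_. 0) \<in> trig_polys_real"
  unfolding trig_polys_real_def mem_Collect_eq by (rule exI[of _ 0]) simp

lemma trig_polys_real_add_term:
  assumes "p \<in> trig_polys_real"
  shows "(\<lambda>t. p t + (cos (\<omega> * t) *\<^sub>R a + sin (\<omega> * t) *\<^sub>R b)) \<in> trig_polys_real"
proof -
  obtain N :: nat and W A B where p: "p = (\<lambda>t. \<Sum>j<N. cos (W j * t) *\<^sub>R A j + sin (W j * t) *\<^sub>R B j)"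
    using assms unfolding trig_polys_real_def by blast
  have "(\<lambda>t. p t + (cos (\<omega> * t) *\<^sub>R a + sin (\<omega> * t) *\<^sub>R b)) = (\<lambda>t. \<Sum>j<Suc N.
      cos ((W(N := \<omega>)) j * t) *\<^sub>R (A(N := a)) j + sin ((W(N := \<omega>)) j * t) *\<^sub>R (B(N := b)) j)"
    unfolding p by (auto intro!: sum.cong)
  then show ?thesis unfolding trig_polys_real_def mem_Collect_eq by blast
qed

lemma trig_polys_real_induct [consumes 1, case_names zero add_term]:
  assumes "p \<in> trig_polys_real" and "P (\<lambda>_. 0)"
    and step: "\<And>p \<omega> a b. p \<in> trig_polys_real \<Longrightarrow> P p \<Longrightarrow>
      P (\<lambda>t. p t + (cos (\<omega> * t) *\<^sub>R a + sin (\<omega> * t) *\<^sub>R b))"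
  shows "P p"
proof -
  obtain N :: nat and W A B where p: "p = (\<lambda>t. \<Sum>j<N. cos (W j * t) *\<^sub>R A j + sin (W j * t) *\<^sub>R B j)"
    using assms(1) unfolding trig_polys_real_def by blast
  have "P (\<lambda>t. \<Sum>j<n. cos (W j * t) *\<^sub>R A j + sin (W j * t) *\<^sub>R B j)" for n
  proof (induction n)
    case (Suc n)
    have "(\<lambda>t. \<Sum>j<n. cos (W j * t) *\<^sub>R A j + sin (W j * t) *\<^sub>R B j) \<in> trig_polys_real"
      unfolding trig_polys_real_def by blast
    from step[OF this Suc] show ?case by simp
  qed (use assms(2) in simp)
  then show ?thesis unfolding p .
qed

lemma trig_polys_real_add:
  assumes "p \<in> trig_polys_real" and "q \<in> trig_polys_real"
  shows "(\<lambda>t. p t + q t) \<in> trig_polys_real"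
  using assms(2)
proof (induction rule: trig_polys_real_induct)
  case (add_term q \<omega> a b)
  from trig_polys_real_add_term[OF add_term(2)] show ?case by (simp add: add.assoc)
qed (use assms(1) in simp)

lemma trig_polys_real_scaleR:
  assumes "p \<in> trig_polys_real"
  shows "(\<lambda>t. c *\<^sub>R p t) \<in> trig_polys_real"
  using assms
proof (induction rule: trig_polys_real_induct)
  case (add_term p \<omega> a b)
  from trig_polys_real_add_term[OF add_term(2), of \<omega> "c *\<^sub>R a" "c *\<^sub>R b"]
  show ?case by (simp add: scaleR_add_right mult.commute)
qed (use trig_polys_real_zero in simp)

lemma trig_polys_real_const: "(\<lambda>_. a) \<in> trig_polys_real"
  using trig_polys_real_add_term[OF trig_polys_real_zero, of 0 a 0] by simp

text \<open>
  Product-to-sum formulas.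
\<close>
lemma trig_polys_real_mult_cos:
  assumes "p \<in> trig_polys_real"
  shows "(\<lambda>t. cos (\<nu> * t) *\<^sub>R p t) \<in> trig_polys_real"
  using assms
proof (induction rule: trig_polys_real_induct)
  case (add_term p \<omega> a b)
  have "cos (\<nu> * t) *\<^sub>R (cos (\<omega> * t) *\<^sub>R a + sin (\<omega> * t) *\<^sub>R b) =
      (cos ((\<omega> + \<nu>) * t) *\<^sub>R ((1/2) *\<^sub>R a) + sin ((\<omega> + \<nu>) * t) *\<^sub>R ((1/2) *\<^sub>R b))
    + (cos ((\<omega> - \<nu>) * t) *\<^sub>R ((1/2) *\<^sub>R a) + sin ((\<omega> - \<nu>) * t) *\<^sub>R ((1/2) *\<^sub>R b))" for t
  proof -
    have c: "cos (\<nu> * t) * cos (\<omega> * t) = cos ((\<omega> + \<nu>) * t) * (1/2) + cos ((\<omega> - \<nu>) * t) * (1/2)"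
      by (simp add: cos_add cos_diff algebra_simps)
    have s: "cos (\<nu> * t) * sin (\<omega> * t) = sin ((\<omega> + \<nu>) * t) * (1/2) + sin ((\<omega> - \<nu>) * t) * (1/2)"
      by (simp add: sin_add sin_diff algebra_simps)
    show ?thesis unfolding scaleR_add_right scaleR_scaleR c s scaleR_add_left by (simp only: ac_simps)
  qed
  then have "(\<lambda>t. cos (\<nu> * t) *\<^sub>R (p t + (cos (\<omega> * t) *\<^sub>R a + sin (\<omega> * t) *\<^sub>R b))) =
    (\<lambda>t. cos (\<nu> * t) *\<^sub>R p t
      + (cos ((\<omega> + \<nu>) * t) *\<^sub>R ((1/2) *\<^sub>R a) + sin ((\<omega> + \<nu>) * t) *\<^sub>R ((1/2) *\<^sub>R b))
      + (cos ((\<omega> - \<nu>) * t) *\<^sub>R ((1/2) *\<^sub>R a) + sin ((\<omega> - \<nu>) * t) *\<^sub>R ((1/2) *\<^sub>R b)))"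
    by (intro ext) (simp only: scaleR_add_right[of _ "p _"] add.assoc)
  moreover have "\<dots> \<in> trig_polys_real"
    by (intro trig_polys_real_add_term add_term)
  ultimately show ?case by simp
qed (use trig_polys_real_zero in simp)

lemma trig_polys_real_trig_sum:
  assumes "p \<in> trig_polys_real"
  shows "(\<lambda>t. trig_sum t *\<^sub>R p t) \<in> trig_polys_real"
proof -
  have "(\<lambda>t. 2 *\<^sub>R p t + cos (1 * t) *\<^sub>R p t + cos (sqrt 2 * t) *\<^sub>R p t) \<in> trig_polys_real"
    using assms by (intro trig_polys_real_add trig_polys_real_scaleR trig_polys_real_mult_cos)
  then show ?thesis by (simp add: trig_sum_def scaleR_add_left)
qed

text \<open>
  Approximate \<open>\<phi>\<close> on the range of the trigonometric sum by polynomials; a polynomial in a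
  trigonometric polynomial is a trigonometric polynomial.
\<close>
lemma continuous_trig_sum_in_AP:
  fixes x :: "'x::banach"
  assumes "continuous_on {0..4} \<phi>"
  shows "(\<lambda>t. \<phi> (trig_sum t) *\<^sub>R x) \<in> uniform_limits trig_polys_real"
proof -
  have ex: "\<exists>p\<in>trig_polys_real. \<forall>t. norm (p t - \<phi> (trig_sum t) *\<^sub>R x) < e" if "e > 0" for e
  proof -
    define d where "d = e / (norm x + 1)"
    have "d > 0" using that by (simp add: d_def add_nonneg_pos)
    from Stone_Weierstrass_real_polynomial_function[OF compact_Icc assms this]
    obtain g where g: "real_polynomial_function g" "\<And>v. v \<in> {0..4} \<Longrightarrow> \<bar>\<phi> v - g v\<bar> < d" by auto
    obtain a n where an: "g = (\<lambda>v. \<Sum>i\<le>n. a i * v ^ i)"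
      using g(1) unfolding real_polynomial_function_iff_sum by blast
    have pow: "(\<lambda>t. trig_sum t ^ i *\<^sub>R x) \<in> trig_polys_real" for i
    proof (induction i)
      case (Suc i)
      from trig_polys_real_trig_sum[OF this] show ?case by simp
    qed (simp add: trig_polys_real_const)
    have "(\<lambda>t. (\<Sum>i\<le>k. a i * trig_sum t ^ i) *\<^sub>R x) \<in> trig_polys_real" for k
    proof (induction k)
      case 0
      show ?case by (simp add: trig_polys_real_const)
    next
      case (Suc k)
      from trig_polys_real_add[OF this trig_polys_real_scaleR[OF pow[of "Suc k"], of "a (Suc k)"]]
      show ?case by (simp add: scaleR_add_left)
    qed
    then have "(\<lambda>t. g (trig_sum t) *\<^sub>R x) \<in> trig_polys_real" unfolding an .
    moreover have "norm (g (trig_sum t) *\<^sub>R x - \<phi> (trig_sum t) *\<^sub>R x) < e" for t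
    proof -
      have "norm (g (trig_sum t) *\<^sub>R x - \<phi> (trig_sum t) *\<^sub>R x) = \<bar>\<phi> (trig_sum t) - g (trig_sum t)\<bar> * norm x"
        by (simp add: scaleR_diff_left[symmetric] abs_minus_commute)
      also have "\<dots> \<le> d * norm x"
        using g(2)[of "trig_sum t"] trig_sum_pos[of t] trig_sum_le[of t] by (intro mult_right_mono) auto
      also have "\<dots> < d * (norm x + 1)" using \<open>d > 0\<close> by simp
      also have "\<dots> = e" using norm_ge_zero[of x] unfolding d_def by (simp add: add_nonneg_eq_0_iff)
      finally show ?thesis .
    qed
    ultimately show ?thesis by (intro bexI[of _ "\<lambda>t. g (trig_sum t) *\<^sub>R x"]) auto
  qed
  have "\<exists>p. p \<in> trig_polys_real \<and> (\<forall>t. norm (p t - \<phi> (trig_sum t) *\<^sub>R x) < inverse (real (Suc n)))" for n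
    using ex[of "inverse (real (Suc n))"] by auto
  then obtain p where p: "\<And>n. p n \<in> trig_polys_real"
    "\<And>n t. norm (p n t - \<phi> (trig_sum t) *\<^sub>R x) < inverse (real (Suc n))" by metis
  have "uniform_limit UNIV p (\<lambda>t. \<phi> (trig_sum t) *\<^sub>R x) sequentially"
  proof (rule uniform_limitI)
    fix e :: real assume "e > 0"
    then have "\<forall>\<^sub>F n in sequentially. inverse (real (Suc n)) < e"
      using order_tendstoD(2)[OF LIMSEQ_inverse_real_of_nat] by blast
    then show "\<forall>\<^sub>F n in sequentially. \<forall>t\<in>UNIV. dist (p n t) (\<phi> (trig_sum t) *\<^sub>R x) < e"
      by eventually_elim (use p(2) in \<open>auto simp: dist_norm simp del: of_nat_Suc intro: less_trans\<close>)
  qed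
  with p(1) show ?thesis unfolding uniform_limits_def by blast
qed

lemma trig_polys_complex_add_term:
  assumes "p \<in> trig_polys_complex scaleC"
  shows "(\<lambda>t. p t + scaleC (exp (\<i> * complex_of_real (\<omega> * t))) a) \<in> trig_polys_complex scaleC"
proof -
  obtain N :: nat and W :: "nat \<Rightarrow> real" and A
    where p: "p = (\<lambda>t. \<Sum>j<N. scaleC (exp (\<i> * complex_of_real (W j * t))) (A j))"
    using assms unfolding trig_polys_complex_def by blast
  have "(\<lambda>t. p t + scaleC (exp (\<i> * complex_of_real (\<omega> * t))) a) = (\<lambda>t. \<Sum>j<Suc N.
      scaleC (exp (\<i> * complex_of_real ((W(N := \<omega>)) j * t))) ((A(N := a)) j))"
    unfolding p by (auto intro!: sum.cong)
  then show ?thesis unfolding trig_polys_complex_def mem_Collect_eq by blast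
qed

text \<open>
  Euler's formula:
  \<open>cos (\<omega> t) a + sin (\<omega> t) b = e\<^bsup>i\<omega>t\<^esup> (a - i b)/2 + e\<^bsup>-i\<omega>t\<^esup> (a + i b)/2\<close>.
\<close>
lemma trig_polys_real_subset_complex:
  fixes scaleC :: "complex \<Rightarrow> 'x::banach \<Rightarrow> 'x"
  assumes "complex_banach_space scaleC"
  shows "trig_polys_real \<subseteq> trig_polys_complex scaleC"
proof
  interpret complex_banach_space scaleC by fact
  fix p :: "real \<Rightarrow> 'x" assume "p \<in> trig_polys_real"
  then show "p \<in> trig_polys_complex scaleC"
  proof (induction rule: trig_polys_real_induct)
    case zero
    show ?case unfolding trig_polys_complex_def mem_Collect_eq by (rule exI[of _ 0]) simp
  next
    case (add_term p \<omega> a b)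
    define c d where "c = scaleC (1/2) a + scaleC (- \<i> / 2) b" and "d = scaleC (1/2) a + scaleC (\<i> / 2) b"
    have "(\<lambda>t. p t + scaleC (exp (\<i> * complex_of_real (\<omega> * t))) c
        + scaleC (exp (\<i> * complex_of_real ((- \<omega>) * t))) d) \<in> trig_polys_complex scaleC"
      by (intro trig_polys_complex_add_term add_term)
    moreover have "scaleC (exp (\<i> * complex_of_real (\<omega> * t))) c
        + scaleC (exp (\<i> * complex_of_real ((- \<omega>) * t))) d = cos (\<omega> * t) *\<^sub>R a + sin (\<omega> * t) *\<^sub>R b" for t
    proof -
      let ?e = "exp (\<i> * complex_of_real (\<omega> * t))" and ?f = "exp (\<i> * complex_of_real ((- \<omega>) * t))"
      have e: "?e = complex_of_real (cos (\<omega> * t)) + \<i> * complex_of_real (sin (\<omega> * t))"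
        and f: "?f = complex_of_real (cos (\<omega> * t)) - \<i> * complex_of_real (sin (\<omega> * t))"
        unfolding exp_Euler by (simp_all flip: cos_of_real sin_of_real)
      have "scaleC ?e c + scaleC ?f d = scaleC (?e * (1/2) + ?f * (1/2)) a + scaleC (?e * (- \<i> / 2) + ?f * (\<i> / 2)) b"
        unfolding c_def d_def scale_right_distrib scale_left_distrib scale_scale by (simp only: ac_simps)
      also have "?e * (1/2) + ?f * (1/2) = complex_of_real (cos (\<omega> * t))"
        unfolding e f by (simp add: field_simps)
      also have "?e * (- \<i> / 2) + ?f * (\<i> / 2) = complex_of_real (sin (\<omega> * t))"
        unfolding e f by (simp add: field_simps)
      finally show ?thesis by (simp only: scaleC_of_real)
    qed
    ultimately show ?case by (simp only: add.assoc)
  qed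
qed

lemma AP_real_subset_AP_complex:
  assumes "complex_banach_space scaleC"
  shows "AP_real J \<subseteq> AP_complex scaleC J"
  using trig_polys_real_subset_complex[OF assms]
  unfolding AP_real_def AP_complex_def uniform_limits_def by blast

section \<open>Means of functions\<close>

lemma admissible_interval_upward: "admissible_interval J \<Longrightarrow> t \<in> J \<Longrightarrow> t \<le> s \<Longrightarrow> s \<in> J"
  unfolding admissible_interval_def by auto

lemma admissible_interval_Icc: "admissible_interval J \<Longrightarrow> a \<in> J \<Longrightarrow> {a..b} \<subseteq> J"
  using admissible_interval_upward by fastforce

lemma admissible_interval_lebesgue: "admissible_interval J \<Longrightarrow> J \<in> sets lebesgue"
  unfolding admissible_interval_def by auto

lemma admissible_interval_nonempty: "admissible_interval J \<Longrightarrow> \<exists>a. a \<in> J"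
  unfolding admissible_interval_def by (metis UNIV_I atLeast_iff greaterThan_iff gt_ex order_refl)

lemma mean_pos_eq_integral:
  fixes f :: "real \<Rightarrow> 'b::banach"
  assumes "h > 0" "continuous_on {t..t + h} f"
  shows "mean h f t = (1 / h) *\<^sub>R integral {t..t + h} f"
proof -
  have c: "continuous_on {0..h} (\<lambda>s. f (t + s))"
    by (intro continuous_on_compose2[OF assms(2)] continuous_intros) auto
  have "bochner_integral (lebesgue_on {0..h}) (\<lambda>s. f (t + s)) = integral {0..h} (\<lambda>s. f (t + s))"
    by (rule bochner_integral_eqI, rule bochner_has_integral_continuous) (use c in auto)
  also have "\<dots> = integral {t..t + h} f"
    using integral_shift_Icc_real[of 0 h f t] by (simp add: o_def add.commute)
  finally show ?thesis using assms(1) by (simp add: mean_def)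
qed

lemma mean_neg_eq_integral:
  fixes f :: "real \<Rightarrow> 'b::banach"
  assumes "h > 0" "continuous_on {t - h..t} f"
  shows "mean (- h) f t = (1 / h) *\<^sub>R integral {t - h..t} f"
proof -
  have c: "continuous_on {- h..0} (\<lambda>s. f (t + s))"
    by (intro continuous_on_compose2[OF assms(2)] continuous_intros) auto
  have "bochner_integral (lebesgue_on {- h..0}) (\<lambda>s. f (t + s)) = integral {- h..0} (\<lambda>s. f (t + s))"
    by (rule bochner_integral_eqI, rule bochner_has_integral_continuous) (use c in auto)
  also have "\<dots> = integral {t - h..t} f"
    using integral_shift_Icc_real[of "- h" 0 f t] by (simp add: o_def add.commute)
  finally show ?thesis using assms(1) by (simp add: mean_def)
qed

lemma mean_eq_diff_quot:
  fixes g :: "real \<Rightarrow> 'b::banach"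
  assumes J: "admissible_interval J" and t: "t \<in> J" and h: "h > 0"
    and g': "continuous_on UNIV g'" and der: "\<And>s. (g has_vector_derivative g' s) (at s)"
    and f: "\<And>s. s \<in> J \<Longrightarrow> f s = g' s"
  shows "mean h f t = diff_quot h g t"
proof -
  have f': "f s = g' s" if "s \<in> {t..t + h}" for s
    using f admissible_interval_Icc[OF J t] that by blast
  have "continuous_on {t..t + h} g'" using g' by (rule continuous_on_subset) simp
  then have "continuous_on {t..t + h} f" by (subst continuous_on_cong[OF refl f'])
  then have "mean h f t = (1 / h) *\<^sub>R integral {t..t + h} f" by (rule mean_pos_eq_integral[OF h])
  also have "integral {t..t + h} f = integral {t..t + h} g'" by (rule integral_cong) (rule f')
  also have "\<dots> = g (t + h) - g t"
    by (rule integral_unique, rule fundamental_theorem_of_calculus)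
      (use h der in \<open>auto intro: has_vector_derivative_at_within\<close>)
  finally show ?thesis by (simp add: diff_quot_def)
qed

lemma continuous_in_L1_loc:
  assumes "continuous_on J g"
  shows "restrict g J \<in> L1_loc J"
proof -
  have "bochner_integrable (lebesgue_on {a..b}) (restrict g J)" if "{a..b} \<subseteq> J" for a b
  proof -
    have "restrict g J s = g s" if "s \<in> {a..b}" for s using that \<open>{a..b} \<subseteq> J\<close> by auto
    then have "continuous_on {a..b} (restrict g J)"
      using continuous_on_subset[OF assms \<open>{a..b} \<subseteq> J\<close>] by (subst continuous_on_cong[OF refl])
    then have "bochner_has_integral (lebesgue_on {a..b}) (restrict g J) (integral {a..b} (restrict g J))"
      by (intro bochner_has_integral_continuous) auto
    then show ?thesis unfolding bochner_integrable_def by blast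
  qed
  then show ?thesis by (simp add: L1_loc_def)
qed

text \<open>
  The step of the chain for functions, in the form required by \<open>funpow_averaging_strict\<close>.
\<close>
lemma derivative_in_avg_class_iff:
  fixes g g' :: "real \<Rightarrow> 'x::banach"
  assumes J: "admissible_interval J"
    and g': "continuous_on UNIV g'" and der: "\<And>s. (g has_vector_derivative g' s) (at s)"
  shows "restrict g' J \<in> avg_class J B \<longleftrightarrow> (\<forall>h>0. restrict (diff_quot h g) J \<in> B)"
proof -
  have "restrict g' J \<in> L1_loc J"
    using g' continuous_on_subset by (intro continuous_in_L1_loc) blast
  moreover have "restrict (mean h (restrict g' J)) J = restrict (diff_quot h g) J" if "h > 0" for h
    using mean_eq_diff_quot[OF J _ that g' der] by (intro restrict_ext) simp
  ultimately show ?thesis unfolding avg_class_def by auto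
qed

text \<open>
  This makes the first inclusion of the chain independent of the chosen representatives.
\<close>
lemma mean_cong_negligible:
  fixes f g :: "real \<Rightarrow> 'b::banach"
  assumes J: "admissible_interval J" and t: "t \<in> J" and h: "h > 0"
    and N: "negligible {s\<in>J. f s \<noteq> g s}"
  shows "mean h f t = mean h g t"
proof -
  have "negligible ((\<lambda>s. - t + s) ` {s\<in>J. f s \<noteq> g s})"
    using negligible_translation[OF N, of "- t"] .
  then have "negligible {s\<in>{0..h}. f (t + s) \<noteq> g (t + s)}"
  proof (rule negligible_subset)
    show "{s\<in>{0..h}. f (t + s) \<noteq> g (t + s)} \<subseteq> (\<lambda>s. - t + s) ` {s\<in>J. f s \<noteq> g s}"
    proof
      fix s assume "s \<in> {s\<in>{0..h}. f (t + s) \<noteq> g (t + s)}"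
      then have "t + s \<in> {s\<in>J. f s \<noteq> g s}" using admissible_interval_upward[OF J t] by auto
      then show "s \<in> (\<lambda>s. - t + s) ` {s\<in>J. f s \<noteq> g s}" by (rule rev_image_eqI) simp
    qed
  qed
  then have "bochner_has_integral (lebesgue_on {0..h}) (\<lambda>s. f (t + s)) = bochner_has_integral (lebesgue_on {0..h}) (\<lambda>s. g (t + s))"
    by (intro ext bochner_has_integral_cong_negligible) auto
  then have "bochner_integral (lebesgue_on {0..h}) (\<lambda>s. f (t + s)) = bochner_integral (lebesgue_on {0..h}) (\<lambda>s. g (t + s))"
    unfolding bochner_integral_def by (simp only:)
  then show ?thesis using h by (simp add: mean_def)
qed

lemma subset_ae_closure: "A \<subseteq> avg_class J A \<Longrightarrow> A \<subseteq> ae_closure J A"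
  unfolding ae_closure_def avg_class_def by auto

lemma ae_closure_subset_avg_class:
  assumes J: "admissible_interval J" and A: "A \<subseteq> avg_class J A"
  shows "ae_closure J A \<subseteq> avg_class J (ae_closure J A)"
proof
  fix f assume "f \<in> ae_closure J A"
  then obtain g where f: "f \<in> L1_loc J" and g: "g \<in> A" and ae: "AE t in lebesgue_on J. f t = g t"
    unfolding ae_closure_def by blast
  have N: "negligible {s\<in>J. f s \<noteq> g s}"
    using ae by (simp add: AE_lebesgue_on_iff_negligible admissible_interval_lebesgue[OF J])
  have "restrict (mean h f) J \<in> ae_closure J A" if "h > 0" for h
  proof -
    have "restrict (mean h f) J = restrict (mean h g) J"
      using mean_cong_negligible[OF J _ that N] by (intro restrict_ext)
    moreover have "restrict (mean h g) J \<in> A"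
      using g A that unfolding avg_class_def by blast
    ultimately show ?thesis using subset_ae_closure[OF A] by auto
  qed
  with f show "f \<in> avg_class J (ae_closure J A)" unfolding avg_class_def by blast
qed

text \<open>
  An exceptional point would have a right neighbourhood of exceptional points, and every
  right neighbourhood has positive measure. Working to the right of the point also covers
  the left endpoint of a closed half-line.
\<close>
lemma continuous_eq_if_negligible:
  fixes f g :: "real \<Rightarrow> 'b::metric_space"
  assumes J: "admissible_interval J" and "continuous_on J f" "continuous_on J g"
    and N: "negligible {s\<in>J. f s \<noteq> g s}" and t: "t \<in> J"
  shows "f t = g t"
proof (rule ccontr)
  assume ne: "f t \<noteq> g t"
  have c: "continuous_on {t..} f" "continuous_on {t..} g"
    using assms(2,3) admissible_interval_upward[OF J t] by (auto elim!: continuous_on_subset)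
  then have "continuous_on {t..} (\<lambda>s. dist (f s) (g s))" by (intro continuous_intros)
  moreover have "dist (f t) (g t) > 0" using ne by simp
  ultimately obtain d where d: "d > 0" "\<And>s. s \<in> {t..} \<Longrightarrow> dist s t < d \<Longrightarrow>
      dist (dist (f s) (g s)) (dist (f t) (g t)) < dist (f t) (g t)"
    unfolding continuous_on_iff by (metis atLeast_iff order_refl)
  have "box t (t + d) \<subseteq> {s\<in>J. f s \<noteq> g s}"
  proof
    fix s assume "s \<in> box t (t + d)"
    then have s: "t < s" "s < t + d" by auto
    then have "dist (dist (f s) (g s)) (dist (f t) (g t)) < dist (f t) (g t)"
      by (intro d(2)) (auto simp: dist_real_def)
    then have "f s \<noteq> g s" by (auto simp: dist_real_def)
    then show "s \<in> {s\<in>J. f s \<noteq> g s}" using admissible_interval_upward[OF J t] s by auto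
  qed
  then have "negligible (box t (t + d))" using N negligible_subset by blast
  then have "box t (t + d) = {}" by (simp only: negligible_interval)
  then show False using d(1) by simp
qed

lemma uniformly_continuous_if_in_ae_closure:
  fixes g :: "real \<Rightarrow> 'x::banach"
  assumes J: "admissible_interval J" and A: "A \<subseteq> C_u J"
    and g: "continuous_on J g" and "restrict g J \<in> ae_closure J A"
  shows "uniformly_continuous_on J g"
proof -
  obtain a where a: "a \<in> A" and ae: "AE t in lebesgue_on J. restrict g J t = a t"
    using assms(4) unfolding ae_closure_def by blast
  have uc: "uniformly_continuous_on J a" using a A unfolding C_u_def by blast
  have "negligible {s\<in>J. restrict g J s \<noteq> a s}"
    using ae by (simp only: AE_lebesgue_on_iff_negligible[OF admissible_interval_lebesgue[OF J]])
  then have "negligible {s\<in>J. g s \<noteq> a s}" by (rule negligible_subset) auto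
  then have "g t = a t" if "t \<in> J" for t
    by (rule continuous_eq_if_negligible[OF J g uniformly_continuous_imp_continuous[OF uc] _ that])
  with uc show ?thesis unfolding uniformly_continuous_on_def by simp
qed

section \<open>Strictness of the chain of an averaging operation\<close>

lemma funpow_diff_quot_scaleR:
  "(diff_quot h ^^ n) (\<lambda>t. f t *\<^sub>R x) = (\<lambda>t. (diff_quot h ^^ n) f t *\<^sub>R x)"
proof (induction n)
  case (Suc n)
  have "diff_quot h (\<lambda>t. g t *\<^sub>R x) = (\<lambda>t. diff_quot h g t *\<^sub>R x)" for g :: "real \<Rightarrow> real"
    by (simp add: diff_quot_def scaleR_diff_left[symmetric] fun_eq_iff)
  with Suc show ?case by simp
qed simp

lemma derivative_chain_continuous: "derivative_chain G \<Longrightarrow> continuous_on S (G k)"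
  unfolding derivative_chain_def
  by (meson continuous_at_imp_continuous_on has_vector_derivative_continuous)

lemma derivative_chain_diff_quot:
  assumes "derivative_chain G" shows "derivative_chain (\<lambda>k. diff_quot h (G k))"
  using assms unfolding derivative_chain_def
  by (auto intro: funpow_diff_quot_has_vector_derivative[where n = "Suc 0", simplified])

text \<open>
  Here \<open>e\<close> embeds functions on the line into the objects that form the chain (restriction to
  \<open>J\<close>, or the regular distribution), and \<open>\<A>\<close> is the operation that generates the chain from
  \<open>B0\<close>. The hypothesis \<open>deriv\<close> says that the mean of a derivative is a difference quotient.
  An induction with a varying smooth function then moves one averaging operation at a time
  onto the function: upwards it shows that the \<open>k\<close>-th derivative is in the \<open>k\<close>-th class,
  downwards that the membership of the derivative of order \<open>n + 1\<close> in the \<open>n\<close>-th class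
  makes the \<open>n\<close>-fold difference quotient of the first derivative uniformly continuous.
\<close>
lemma funpow_averaging_strict:
  fixes e :: "(real \<Rightarrow> 'x::banach) \<Rightarrow> 'b" and \<A> :: "'b set \<Rightarrow> 'b set" and A :: "(real \<Rightarrow> 'x) set"
  assumes x: "\<exists>x::'x. x \<noteq> 0" and J: "admissible_interval J"
    and lin: "real_linear_on J A" and inv: "positive_invariant_on J A" and AP: "AP_real J \<subseteq> A"
    and mono: "\<And>B C. B \<subseteq> C \<Longrightarrow> \<A> B \<subseteq> \<A> C" and base: "B0 \<subseteq> \<A> B0"
    and deriv: "\<And>g g' B. continuous_on UNIV g' \<Longrightarrow> (\<And>s. (g has_vector_derivative g' s) (at s)) \<Longrightarrow>
      e g' \<in> \<A> B \<longleftrightarrow> (\<forall>h>0. e (diff_quot h g) \<in> B)"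
    and sub: "\<And>g. restrict g J \<in> A \<Longrightarrow> e g \<in> B0"
    and uc: "\<And>g. continuous_on UNIV g \<Longrightarrow> e g \<in> B0 \<Longrightarrow> uniformly_continuous_on J g"
  shows "(\<A> ^^ n) B0 \<subset> (\<A> ^^ Suc n) B0"
proof -
  have A_diff: "restrict (diff_quot h g) J \<in> A" if h: "h > 0" and g: "restrict g J \<in> A" for h g
  proof -
    have "(\<lambda>t\<in>J. restrict g J (t + h)) \<in> A"
      using inv g h unfolding positive_invariant_on_def by force
    then have "(\<lambda>u\<in>J. (1 / h) *\<^sub>R (\<lambda>t\<in>J. restrict g J (t + h)) u + (- 1 / h) *\<^sub>R restrict g J u) \<in> A"
      using lin g unfolding real_linear_on_def by blast
    moreover have "u + h \<in> J" if "u \<in> J" for u using admissible_interval_upward[OF J that] h by simp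
    then have "(\<lambda>u\<in>J. (1 / h) *\<^sub>R (\<lambda>t\<in>J. restrict g J (t + h)) u + (- 1 / h) *\<^sub>R restrict g J u) = restrict (diff_quot h g) J"
      by (intro restrict_ext) (simp add: diff_quot_def scaleR_diff_right)
    ultimately show ?thesis by simp
  qed
  have step: "e (G (Suc k)) \<in> \<A> B \<longleftrightarrow> (\<forall>h>0. e (diff_quot h (G k)) \<in> B)" if "derivative_chain G" for G k B
    using derivative_chain_continuous[OF that, of UNIV "Suc k"] that deriv[of "G (Suc k)" "G k" B]
    unfolding derivative_chain_def by simp
  have mem: "e (G k) \<in> (\<A> ^^ k) B0" if "derivative_chain G" "restrict (G 0) J \<in> A" for G k
    using that
  proof (induction k arbitrary: G)
    case 0
    show ?case using sub[OF 0(2)] by simp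
  next
    case (Suc k)
    have "e (diff_quot h (G k)) \<in> (\<A> ^^ k) B0" if "h > 0" for h
      using Suc.IH[of "\<lambda>k. diff_quot h (G k)"] derivative_chain_diff_quot[OF Suc.prems(1)] A_diff[OF that Suc.prems(2)]
      by blast
    then show ?case using step[OF Suc.prems(1)] by simp
  qed
  have nonmem: "uniformly_continuous_on J ((diff_quot h ^^ k) (G 1))"
    if "h > 0" "derivative_chain G" "e (G (Suc k)) \<in> (\<A> ^^ k) B0" for G k h
    using that(2,3)
  proof (induction k arbitrary: G)
    case 0
    then show ?case using uc[OF derivative_chain_continuous[OF 0(1)]] by simp
  next
    case (Suc k)
    have "e (diff_quot h (G (Suc k))) \<in> (\<A> ^^ k) B0"
      using Suc.prems step[OF Suc.prems(1)] that(1) by simp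
    from Suc.IH[OF derivative_chain_diff_quot[OF Suc.prems(1), of h] this]
    show ?case by (simp add: funpow_swap1)
  qed
  have subset: "(\<A> ^^ k) B0 \<subseteq> (\<A> ^^ Suc k) B0" for k
  proof (induction k)
    case (Suc k)
    from mono[OF this] show ?case by simp
  qed (use base in simp)
  obtain x :: 'x where x: "x \<noteq> 0" using assms(1) by blast
  obtain F where F0: "F 0 = (\<lambda>t. trig_sum t powr (1/4))" and F: "derivative_chain F"
    using derivative_chain_trig_sum_powr by blast
  define G where "G k t = F k t *\<^sub>R x" for k t
  have G: "derivative_chain G"
    using F unfolding derivative_chain_def G_def
    by (auto intro: bounded_linear.has_vector_derivative[OF bounded_linear_scaleR_left])
  have "continuous_on {0..4::real} (\<lambda>v. v powr (1/4))"
    by (intro continuous_on_powr' continuous_intros) auto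
  from continuous_trig_sum_in_AP[OF this, of x] have "G 0 \<in> uniform_limits trig_polys_real"
    by (simp add: G_def[abs_def] F0)
  then have "restrict (G 0) J \<in> A" using AP unfolding AP_real_def by blast
  then have "e (G (Suc n)) \<in> (\<A> ^^ Suc n) B0" by (rule mem[OF G])
  moreover have "e (G (Suc n)) \<notin> (\<A> ^^ n) B0"
  proof
    let ?h = "1 / real (Suc n)"
    assume "e (G (Suc n)) \<in> (\<A> ^^ n) B0"
    then have "uniformly_continuous_on J ((diff_quot ?h ^^ n) (G 1))"
      by (intro nonmem G) auto
    then have vec: "uniformly_continuous_on J (\<lambda>t. (diff_quot ?h ^^ n) (F 1) t *\<^sub>R x)"
      by (simp only: G_def[abs_def] funpow_diff_quot_scaleR)
    obtain a where "a \<in> J" using admissible_interval_nonempty[OF J] by blast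
    then have "{a..} \<subseteq> J" using admissible_interval_upward[OF J] by auto
    have "uniformly_continuous_on {a..} ((diff_quot ?h ^^ n) (F 1))"
      unfolding uniformly_continuous_on_def
    proof (intro allI impI)
      fix \<epsilon> :: real assume "\<epsilon> > 0"
      then obtain d where "d > 0" and d: "\<And>s t. s \<in> J \<Longrightarrow> t \<in> J \<Longrightarrow> dist t s < d \<Longrightarrow>
          dist ((diff_quot ?h ^^ n) (F 1) t *\<^sub>R x) ((diff_quot ?h ^^ n) (F 1) s *\<^sub>R x) < \<epsilon> * norm x"
        using vec x unfolding uniformly_continuous_on_def by (metis mult_pos_pos zero_less_norm_iff)
      have "dist ((diff_quot ?h ^^ n) (F 1) t) ((diff_quot ?h ^^ n) (F 1) s) < \<epsilon>"
        if "s \<in> {a..}" "t \<in> {a..}" "dist t s < d" for s t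
      proof -
        have "\<bar>(diff_quot ?h ^^ n) (F 1) t - (diff_quot ?h ^^ n) (F 1) s\<bar> * norm x < \<epsilon> * norm x"
          using d[of s t] that \<open>{a..} \<subseteq> J\<close> by (auto simp: dist_norm scaleR_diff_left[symmetric] simp del: of_nat_Suc)
        then show ?thesis using x by (simp add: dist_real_def del: of_nat_Suc)
      qed
      with \<open>d > 0\<close> show "\<exists>d>0. \<forall>s\<in>{a..}. \<forall>t\<in>{a..}. dist t s < d \<longrightarrow>
          dist ((diff_quot ?h ^^ n) (F 1) t) ((diff_quot ?h ^^ n) (F 1) s) < \<epsilon>" by blast
    qed
    then show False using diff_quot_derivative_not_uniformly_continuous[OF F F0] by blast
  qed
  ultimately show ?thesis using subset by blast
qed

text \<open>
  The classes of functions modulo null sets, with \<open>e\<close> the restriction to \<open>J\<close>.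
\<close>
lemma avg_class_chain_strict:
  fixes A :: "(real \<Rightarrow> 'x::banach) set"
  assumes "\<exists>x::'x. x \<noteq> 0" and J: "admissible_interval J" and A: "A \<subseteq> C_u J"
    and "real_linear_on J A" and "positive_invariant_on J A"
    and avg: "A \<subseteq> avg_class J A" and "AP_real J \<subseteq> A"
  shows "(avg_class J ^^ n) (ae_closure J A) \<subset> (avg_class J ^^ Suc n) (ae_closure J A)"
proof (rule funpow_averaging_strict[where e = "\<lambda>g. restrict g J", OF assms(1) J assms(4,5,7)])
  show "avg_class J B \<subseteq> avg_class J C" if "B \<subseteq> C" for B C :: "(real \<Rightarrow> 'x) set"
    using that unfolding avg_class_def by blast
  show "ae_closure J A \<subseteq> avg_class J (ae_closure J A)"
    by (rule ae_closure_subset_avg_class[OF J avg])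
  show "restrict g J \<in> ae_closure J A" if "restrict g J \<in> A" for g
    using that subset_ae_closure[OF avg] by blast
  show "restrict g' J \<in> avg_class J B \<longleftrightarrow> (\<forall>h>0. restrict (diff_quot h g) J \<in> B)"
    if "continuous_on UNIV g'" "\<And>s. (g has_vector_derivative g' s) (at s)" for g g' :: "real \<Rightarrow> 'x" and B
    by (rule derivative_in_avg_class_iff[OF J that])
  show "uniformly_continuous_on J g" if "continuous_on UNIV g" "restrict g J \<in> ae_closure J A" for g
    using uniformly_continuous_if_in_ae_closure[OF J A continuous_on_subset[OF that(1)] that(2)] by simp
qed

section \<open>Test functions\<close>

lemma nth_derivative_Suc: "nth_derivative (Suc n) g = (\<lambda>t. vector_derivative (nth_derivative n g) (at t))"
  by (simp add: nth_derivative_def)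

text \<open>
  A chain of derivatives can be added, scaled and translated termwise, which the iterated
  \<^const>\<open>vector_derivative\<close> does not allow directly.
\<close>
lemma smooth_iff_derivative_chain:
  "(\<forall>n t. nth_derivative n \<phi> differentiable (at t)) \<longleftrightarrow> (\<exists>F. F 0 = \<phi> \<and> derivative_chain F)"
proof
  assume "\<forall>n t. nth_derivative n \<phi> differentiable (at t)"
  then have "derivative_chain (\<lambda>n. nth_derivative n \<phi>)"
    unfolding derivative_chain_def nth_derivative_Suc by (simp add: vector_derivative_works[symmetric])
  moreover have "nth_derivative 0 \<phi> = \<phi>" by (simp add: nth_derivative_def)
  ultimately show "\<exists>F. F 0 = \<phi> \<and> derivative_chain F"
    by (intro exI[of _ "\<lambda>n. nth_derivative n \<phi>"]) blast
next
  assume "\<exists>F. F 0 = \<phi> \<and> derivative_chain F"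
  then obtain F where F: "F 0 = \<phi>" "\<And>k t. (F k has_vector_derivative F (Suc k) t) (at t)"
    unfolding derivative_chain_def by blast
  have eq: "nth_derivative n \<phi> = F n" for n
  proof (induction n)
    case (Suc n)
    show ?case unfolding nth_derivative_Suc Suc using F(2) by (intro ext vector_derivative_at)
  qed (simp add: F(1) nth_derivative_def)
  show "\<forall>n t. nth_derivative n \<phi> differentiable (at t)"
    unfolding eq using F(2) by (metis differentiableI_vector)
qed

text \<open>
  The support lies in a compact interval whose left endpoint is in \<open>J\<close>; the rest of that
  interval is then in \<open>J\<close> too, which is unbounded to the right.
\<close>
lemma test_functions_iff:
  fixes \<phi> :: "real \<Rightarrow> 'k::{real_normed_field, banach}"
  assumes J: "admissible_interval J"
  shows "\<phi> \<in> test_functions J \<longleftrightarrow> (\<exists>F. F 0 = \<phi> \<and> derivative_chain F) \<and>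
    (\<exists>a\<in>J. \<exists>b\<ge>a. \<forall>t. t \<notin> {a..b} \<longrightarrow> \<phi> t = 0)"
proof -
  let ?K = "closure {t. \<phi> t \<noteq> 0}"
  have "compact ?K \<and> ?K \<subseteq> J \<longleftrightarrow> (\<exists>a\<in>J. \<exists>b\<ge>a. \<forall>t. t \<notin> {a..b} \<longrightarrow> \<phi> t = 0)" (is "?L \<longleftrightarrow> ?R")
  proof
    assume K: ?L
    show ?R
    proof (cases "?K = {}")
      case True
      then have "\<phi> t = 0" for t using closure_subset by blast
      then show ?thesis using admissible_interval_nonempty[OF J] by blast
    next
      case False
      obtain a where a: "a \<in> ?K" "\<And>t. t \<in> ?K \<Longrightarrow> a \<le> t"
        using compact_attains_inf[OF _ False] K by blast
      obtain b where b: "b \<in> ?K" "\<And>t. t \<in> ?K \<Longrightarrow> t \<le> b"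
        using compact_attains_sup[OF _ False] K by blast
      have "\<phi> t = 0" if "t \<notin> {a..b}" for t
      proof (rule ccontr)
        assume "\<phi> t \<noteq> 0"
        then have "t \<in> ?K" using closure_subset[of "{t. \<phi> t \<noteq> 0}"] by blast
        then show False using a(2) b(2) that by simp
      qed
      moreover have "a \<in> J" "a \<le> b" using a b K by auto
      ultimately show ?thesis by blast
    qed
  next
    assume ?R
    then obtain a b where ab: "a \<in> J" "\<And>t. t \<notin> {a..b} \<Longrightarrow> \<phi> t = 0" by blast
    then have "{t. \<phi> t \<noteq> 0} \<subseteq> {a..b}" by blast
    then have "?K \<subseteq> {a..b}" by (rule closure_minimal) simp
    moreover then have "compact ?K" using compact_Int_closed[of "{a..b}" ?K] by (simp add: Int_absorb1)
    ultimately show ?L using admissible_interval_Icc[OF J ab(1)] by blast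
  qed
  then show ?thesis unfolding test_functions_def mem_Collect_eq smooth_iff_derivative_chain by blast
qed

lemma test_functionI:
  assumes "admissible_interval J" "derivative_chain F" "F 0 = \<phi>" "a \<in> J" "a \<le> b" "\<And>t. t \<notin> {a..b} \<Longrightarrow> \<phi> t = 0"
  shows "\<phi> \<in> test_functions J"
  unfolding test_functions_iff[OF assms(1)] using assms(2-) by (intro conjI exI[of _ F] bexI[of _ a] exI[of _ b]) auto

lemma test_function_continuous:
  assumes "admissible_interval J" "\<phi> \<in> test_functions J" shows "continuous_on S \<phi>"
proof -
  obtain F where "F 0 = \<phi>" "derivative_chain F" using assms test_functions_iff by blast
  then show ?thesis using derivative_chain_continuous by metis
qed

lemma test_functions_add:
  fixes \<phi> \<psi> :: "real \<Rightarrow> 'k::{real_normed_field, banach}"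
  assumes J: "admissible_interval J" and "\<phi> \<in> test_functions J" "\<psi> \<in> test_functions J"
  shows "(\<lambda>t. \<phi> t + \<psi> t) \<in> test_functions J"
proof -
  obtain F a b where F: "F 0 = \<phi>" "derivative_chain F" and a: "a \<in> J" "a \<le> b" "\<And>t. t \<notin> {a..b} \<Longrightarrow> \<phi> t = 0"
    using assms(2) test_functions_iff[OF J] by blast
  obtain G c d where G: "G 0 = \<psi>" "derivative_chain G" and c: "c \<in> J" "c \<le> d" "\<And>t. t \<notin> {c..d} \<Longrightarrow> \<psi> t = 0"
    using assms(3) test_functions_iff[OF J] by blast
  have "derivative_chain (\<lambda>k t. F k t + G k t)"
    using F(2) G(2) unfolding derivative_chain_def by (auto intro: has_vector_derivative_add)
  moreover have "\<phi> t + \<psi> t = 0" if "t \<notin> {min a c..max b d}" for t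
  proof -
    have "t \<notin> {a..b}" "t \<notin> {c..d}" using that by auto
    then show ?thesis using a(3) c(3) by simp
  qed
  moreover have "min a c \<in> J" "min a c \<le> max b d" using a c by (auto simp: min_def)
  ultimately show ?thesis using F(1) G(1)
    by (intro test_functionI[OF J, of "\<lambda>k t. F k t + G k t"]) auto
qed

lemma test_functions_mult:
  fixes \<phi> :: "real \<Rightarrow> 'k::{real_normed_field, banach}"
  assumes J: "admissible_interval J" and "\<phi> \<in> test_functions J"
  shows "(\<lambda>t. c * \<phi> t) \<in> test_functions J"
proof -
  obtain F a b where F: "F 0 = \<phi>" "derivative_chain F" and a: "a \<in> J" "a \<le> b" "\<And>t. t \<notin> {a..b} \<Longrightarrow> \<phi> t = 0"
    using assms(2) test_functions_iff[OF J] by blast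
  have "derivative_chain (\<lambda>k t. c * F k t)"
    using F(2) unfolding derivative_chain_def
    by (auto intro: bounded_linear.has_vector_derivative[OF bounded_linear_mult_right])
  then show ?thesis
    by (rule test_functionI[OF J _ _ a(1,2)]) (use F(1) a(3) in auto)
qed

text \<open>
  The difference of integrals is the oriented integral from \<open>0\<close> to \<open>s\<close>.
\<close>
lemma continuous_has_antiderivative:
  fixes f :: "real \<Rightarrow> 'a::banach"
  assumes f: "continuous_on UNIV f"
  shows "\<exists>\<Phi>. \<forall>t. (\<Phi> has_vector_derivative f t) (at t)"
proof (intro exI allI)
  fix t :: real
  define c where "c = min t 0 - 1"
  define d where "d = t + 1"
  have cont: "continuous_on S f" for S using f continuous_on_subset by blast
  have ft: "((\<lambda>s. integral {c..s} f) has_vector_derivative f t) (at t)"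
    using integral_has_vector_derivative[OF cont, of t c d]
    by (simp add: c_def d_def at_within_Icc_at)
  have "((\<lambda>s. integral {c..s} f - integral {c..0} f) has_vector_derivative f t) (at t)"
    using has_vector_derivative_diff[OF ft has_vector_derivative_const] by simp
  then show "((\<lambda>s. integral {0..s} f - integral {s..0} f) has_vector_derivative f t) (at t)"
  proof (rule has_vector_derivative_transform_within_open[where S = "{c<..}"])
    fix s assume "s \<in> {c<..}"
    then have "c < s" "c \<le> 0" by (auto simp: c_def)
    moreover have "integral {u..v} f = 0" if "v \<le> u" for u v using that by (cases "u = v") auto
    ultimately show "integral {c..s} f - integral {c..0} f = integral {0..s} f - integral {s..0} f"
      using Henstock_Kurzweil_Integration.integral_combine[where a = c and c = 0 and b = s and f = f] Henstock_Kurzweil_Integration.integral_combine[where a = c and c = s and b = 0 and f = f] integrable_continuous_real[OF cont]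
      by (cases "s \<ge> 0") (auto simp: algebra_simps)
  qed (auto simp: c_def)
qed

text \<open>
  With \<open>\<Phi>' = \<phi>\<close> the mean is \<open>(\<Phi>(t) - \<Phi>(t - h)) / h\<close>. The support is enlarged to the
  right only, hence stays in \<open>J\<close>.
\<close>
lemma mean_neg_test_function:
  fixes \<phi> :: "real \<Rightarrow> 'k::{real_normed_field, banach}"
  assumes J: "admissible_interval J" and "\<phi> \<in> test_functions J" and h: "h > 0"
  shows "mean (- h) \<phi> \<in> test_functions J"
    and "(mean (- h) \<phi> has_vector_derivative (1 / h) *\<^sub>R (\<phi> t - \<phi> (t - h))) (at t)"
proof -
  obtain F a b where F: "F 0 = \<phi>" "derivative_chain F" and a: "a \<in> J" "a \<le> b" "\<And>t. t \<notin> {a..b} \<Longrightarrow> \<phi> t = 0"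
    using assms(2) test_functions_iff[OF J] by blast
  have cont: "continuous_on S \<phi>" for S by (rule test_function_continuous[OF assms(1,2)])
  have shift: "((\<lambda>s. G s - G (s - h)) has_vector_derivative g t - g (t - h)) (at t)"
    if "\<And>t. (G has_vector_derivative g t) (at t)" for G g :: "real \<Rightarrow> 'k" and t
  proof -
    have "((\<lambda>s. s - h) has_vector_derivative 1) (at t)"
      by (auto intro!: derivative_eq_intros)
    from vector_diff_chain_at[OF this that] have "((\<lambda>s. G (s - h)) has_vector_derivative g (t - h)) (at t)"
      by (simp add: o_def)
    then show ?thesis by (intro has_vector_derivative_diff that)
  qed
  obtain \<Phi> where \<Phi>: "\<And>t. (\<Phi> has_vector_derivative \<phi> t) (at t)"
    using continuous_has_antiderivative[OF cont] by blast
  have "mean (- h) \<phi> t = (1 / h) *\<^sub>R (\<Phi> t - \<Phi> (t - h))" for t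
  proof -
    have "integral {t - h..t} \<phi> = \<Phi> t - \<Phi> (t - h)"
      by (rule integral_unique, rule fundamental_theorem_of_calculus)
        (use h \<Phi> in \<open>auto intro: has_vector_derivative_at_within\<close>)
    then show ?thesis using mean_neg_eq_integral[OF h cont] by simp
  qed
  then have mean: "mean (- h) \<phi> = (\<lambda>t. (1 / h) *\<^sub>R (\<Phi> t - \<Phi> (t - h)))" by blast
  have scaled: "((\<lambda>s. (1 / h) *\<^sub>R (G s - G (s - h))) has_vector_derivative (1 / h) *\<^sub>R (g t - g (t - h))) (at t)"
    if "\<And>t. (G has_vector_derivative g t) (at t)" for G g :: "real \<Rightarrow> 'k" and t
    using shift[OF that] by (rule bounded_linear.has_vector_derivative[OF bounded_linear_scaleR_right])
  show der: "(mean (- h) \<phi> has_vector_derivative (1 / h) *\<^sub>R (\<phi> t - \<phi> (t - h))) (at t)" for t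
    unfolding mean by (rule scaled[OF \<Phi>])
  define M where "M k = (case k of 0 \<Rightarrow> mean (- h) \<phi> | Suc k \<Rightarrow> (\<lambda>t. (1 / h) *\<^sub>R (F k t - F k (t - h))))" for k
  have "(M k has_vector_derivative M (Suc k) t) (at t)" for k t
    using F(2) by (cases k) (auto simp: M_def derivative_chain_def der F(1) intro: scaled)
  then have "M 0 = mean (- h) \<phi>" "derivative_chain M" by (simp_all add: M_def derivative_chain_def)
  moreover have "mean (- h) \<phi> t = 0" if "t \<notin> {a..b + h}" for t
  proof -
    have "integral {t - h..t} \<phi> = integral {t - h..t} (\<lambda>_. 0)"
      by (rule integral_cong) (use that a(3) in auto)
    then show ?thesis using mean_neg_eq_integral[OF h cont, of t] by simp
  qed
  moreover have "a \<le> b + h" using a(2) h by simp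
  ultimately show "mean (- h) \<phi> \<in> test_functions J"
    using a(1) by (intro test_functionI[OF J, of M])
qed

section \<open>Bump functions\<close>

definition flat_exp :: "nat \<Rightarrow> real \<Rightarrow> real" where
  "flat_exp k x = (if x > 0 then exp (- inverse x) * inverse x ^ k else 0)"

text \<open>
  At \<open>0\<close> the difference quotient is the function with the next index, which tends to \<open>0\<close>.
  The formula shows that these functions, composed with affine maps, generate an algebra
  that is closed under derivatives.
\<close>
lemma flat_exp_has_derivative:
  "(flat_exp k has_real_derivative flat_exp (k + 2) x - real k * flat_exp (k + 1) x) (at x)"
proof -
  consider "x > 0" | "x < 0" | "x = 0" by linarith
  then show ?thesis
  proof cases
    case 1
    have i: "(inverse has_real_derivative - (inverse x ^ 2)) (at x)"
      using DERIV_inverse[of x UNIV] 1 by (simp add: numeral_2_eq_2)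
    have e: "((\<lambda>x. exp (- inverse x)) has_real_derivative exp (- inverse x) * inverse x ^ 2) (at x)"
      using DERIV_chain2[OF DERIV_exp DERIV_minus[OF i]] by simp
    have "flat_exp (k + 2) x - real k * flat_exp (k + 1) x =
        (exp (- inverse x) * inverse x ^ 2) * inverse x ^ k + (real k * (- (inverse x ^ 2) * inverse x ^ (k - Suc 0))) * exp (- inverse x)"
      using 1 by (cases k) (simp_all add: flat_exp_def power2_eq_square algebra_simps)
    then have "((\<lambda>x. exp (- inverse x) * inverse x ^ k) has_real_derivative
        flat_exp (k + 2) x - real k * flat_exp (k + 1) x) (at x)"
      using DERIV_mult[OF e DERIV_power[OF i, of k]] by simp
    then show ?thesis
      by (rule has_field_derivative_transform_within_open[where S = "{0<..}"]) (use 1 in \<open>auto simp: flat_exp_def\<close>)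
  next
    case 2
    have "((\<lambda>x. 0) has_real_derivative flat_exp (k + 2) x - real k * flat_exp (k + 1) x) (at x)"
      using 2 by (simp add: flat_exp_def)
    then show ?thesis
      by (rule has_field_derivative_transform_within_open[where S = "{..<0}"]) (use 2 in \<open>auto simp: flat_exp_def\<close>)
  next
    case 3
    have "((\<lambda>y. inverse y ^ Suc k / exp (inverse y)) \<longlongrightarrow> 0) (at_right (0::real))"
      by (rule filterlim_compose[OF tendsto_power_div_exp_0 filterlim_inverse_at_top_right])
    then have "((\<lambda>y. flat_exp k y / y) \<longlongrightarrow> 0) (at_right 0)"
      by (rule Lim_transform_eventually)
        (auto simp: flat_exp_def exp_minus field_simps intro!: eventually_at_right_less[THEN eventually_mono])
    moreover have "((\<lambda>y. flat_exp k y / y) \<longlongrightarrow> 0) (at_left 0)"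
      by (rule Lim_transform_eventually[OF tendsto_const])
        (auto simp: flat_exp_def eventually_at_filter)
    ultimately have "((\<lambda>y. flat_exp k y / y) \<longlongrightarrow> 0) (at 0)" by (simp add: filterlim_split_at)
    with 3 show ?thesis by (simp add: DERIV_def flat_exp_def)
  qed
qed

text \<open>
  The product of \<open>exp (-1/(t - a))\<close> and \<open>exp (-1/(b - t))\<close>, each extended by \<open>0\<close>.
\<close>
lemma bump_function:
  fixes a b :: real
  assumes "a < b"
  shows "\<exists>F. derivative_chain F \<and> (\<forall>t. F 0 t \<ge> (0::real)) \<and> (\<forall>t. F 0 t > 0 \<longleftrightarrow> t \<in> {a<..<b})"
proof -
  define B where "B = range (\<lambda>(k, \<alpha>, \<beta>) t. flat_exp k (\<alpha> + \<beta> * t))"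
  have gen: "(\<lambda>t. flat_exp k (\<alpha> + \<beta> * t)) \<in> function_algebra B" for k \<alpha> \<beta>
    unfolding B_def by (rule function_algebra.gen) (rule range_eqI[of _ _ "(k, \<alpha>, \<beta>)"], simp)
  have "\<exists>g\<in>function_algebra B. \<forall>t. (f has_real_derivative g t) (at t)" if f: "f \<in> B" for f
  proof -
    obtain k \<alpha> \<beta> where f: "f = (\<lambda>t. flat_exp k (\<alpha> + \<beta> * t))" using f by (auto simp: B_def)
    have lin: "((\<lambda>t. \<alpha> + \<beta> * t) has_real_derivative \<beta>) (at t)" for t
      by (auto intro!: derivative_eq_intros)
    have "((\<lambda>t. flat_exp k (\<alpha> + \<beta> * t)) has_real_derivative
        (flat_exp (k + 2) (\<alpha> + \<beta> * t) + (- real k) * flat_exp (k + 1) (\<alpha> + \<beta> * t)) * \<beta>) (at t)" for t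
      using DERIV_chain2[OF flat_exp_has_derivative lin] by simp
    then show ?thesis unfolding f
      by (intro bexI[of _ "\<lambda>t. (flat_exp (k + 2) (\<alpha> + \<beta> * t) + (- real k) * flat_exp (k + 1) (\<alpha> + \<beta> * t)) * \<beta>"]
          function_algebra.mult function_algebra.add function_algebra.const gen) blast
  qed
  then obtain F where F: "F 0 = (\<lambda>t. flat_exp 0 (- a + 1 * t) * flat_exp 0 (b + (- 1) * t))" "derivative_chain F"
    using derivative_chain_function_algebra[OF _ function_algebra.mult[OF gen[of 0 "- a" 1] gen[of 0 b "- 1"]]] by blast
  then show ?thesis by (intro exI[of _ F]) (auto simp: flat_exp_def)
qed

section \<open>Regular distributions\<close>

text \<open>
  What the real and the complex scalars have in common; distributions are treated for both
  at once.
\<close>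
locale scalar_action =
  fixes sc :: "'k::{real_normed_field, banach} \<Rightarrow> 'x::banach \<Rightarrow> 'x"
  assumes bilinear: "bounded_bilinear sc"
    and sc_of_real: "sc (of_real r) x = r *\<^sub>R x"
    and sc_mult: "sc (a * b) x = sc a (sc b x)"
    and norm_sc: "norm (sc a x) = norm a * norm x"

lemma scalar_action_scaleR: "scalar_action (scaleR :: real \<Rightarrow> 'x::banach \<Rightarrow> 'x)"
  by (rule scalar_action.intro) (auto intro: bounded_bilinear_scaleR)

lemma (in complex_banach_space) scalar_action_scaleC: "scalar_action scaleC"
proof (rule scalar_action.intro)
  show "bounded_bilinear scaleC"
  proof
    show "scaleC (a + a') b = scaleC a b + scaleC a' b" for a a' b by (rule scale_left_distrib)
    show "scaleC a (b + b') = scaleC a b + scaleC a b'" for a b b' by (rule scale_right_distrib)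
    show "scaleC (r *\<^sub>R a) b = r *\<^sub>R scaleC a b" for r a b
      by (simp add: scaleR_conv_of_real flip: scale_scale scaleC_of_real)
    show "scaleC a (r *\<^sub>R b) = r *\<^sub>R scaleC a b" for r a b
      by (simp add: mult.commute flip: scaleC_of_real)
    show "\<exists>K. \<forall>a b. norm (scaleC a b) \<le> norm a * norm b * K"
      by (intro exI[of _ 1]) (simp add: norm_scaleC)
  qed
qed (simp_all add: scaleC_of_real norm_scaleC)

context scalar_action
begin

interpretation sc: bounded_bilinear sc by (rule bilinear)

lemma regular_distribution_eq_integral:
  assumes J: "admissible_interval J" and f: "continuous_on J f" and \<phi>: "\<phi> \<in> test_functions J"
    and a: "a \<in> J" and supp: "\<And>t. t \<notin> {a..b} \<Longrightarrow> \<phi> t = 0"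
  shows "((\<lambda>t. sc (\<phi> t) (f t)) has_integral regular_distribution sc J f \<phi>) {a..b}"
proof -
  have sub: "{a..b} \<subseteq> J" by (rule admissible_interval_Icc[OF J a])
  have cont: "continuous_on J (\<lambda>t. sc (\<phi> t) (f t))"
    by (intro sc.continuous_on f test_function_continuous[OF J \<phi>])
  have "bochner_has_integral (lebesgue_on J) (\<lambda>t. sc (\<phi> t) (f t)) (integral {a..b} (\<lambda>t. sc (\<phi> t) (f t)))"
    using supp by (intro bochner_has_integral_continuous admissible_interval_lebesgue[OF J] cont sub)
      (auto simp: sc.zero_left)
  then have "regular_distribution sc J f \<phi> = integral {a..b} (\<lambda>t. sc (\<phi> t) (f t))"
    using \<phi> by (simp add: regular_distribution_def bochner_integral_eqI)
  moreover have "(\<lambda>t. sc (\<phi> t) (f t)) integrable_on {a..b}"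
    by (intro integrable_continuous_real continuous_on_subset[OF cont sub])
  ultimately show ?thesis by (simp add: has_integral_integral)
qed

lemma regular_distribution_cong:
  assumes J: "admissible_interval J" and eq: "\<And>t. t \<in> J \<Longrightarrow> f t = g t"
  shows "regular_distribution sc J f = regular_distribution sc J g"
  unfolding regular_distribution_def
proof (rule restrict_ext)
  fix \<phi> :: "real \<Rightarrow> 'k"
  have "bochner_has_integral (lebesgue_on J) (\<lambda>t. sc (\<phi> t) (f t)) = bochner_has_integral (lebesgue_on J) (\<lambda>t. sc (\<phi> t) (g t))"
    using eq by (intro ext bochner_has_integral_cong_negligible admissible_interval_lebesgue[OF J])
      (simp cong: conj_cong)
  then show "bochner_integral (lebesgue_on J) (\<lambda>t. sc (\<phi> t) (f t)) = bochner_integral (lebesgue_on J) (\<lambda>t. sc (\<phi> t) (g t))"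
    unfolding bochner_integral_def by (simp only:)
qed

text \<open>
  On test functions supported in a fixed compact set the estimate holds with the supremum
  norm alone.
\<close>
lemma regular_distribution_in_distributions:
  assumes J: "admissible_interval J" and f: "continuous_on J f"
  shows "regular_distribution sc J f \<in> distributions sc J"
proof -
  let ?T = "regular_distribution sc J f"
  have T_add: "?T (\<lambda>t. \<phi> t + \<psi> t) = ?T \<phi> + ?T \<psi>"
    if \<phi>: "\<phi> \<in> test_functions J" and \<psi>: "\<psi> \<in> test_functions J" for \<phi> \<psi>
  proof -
    obtain a b where a: "a \<in> J" "\<And>t. t \<notin> {a..b} \<Longrightarrow> \<phi> t = 0"
      using \<phi> test_functions_iff[OF J] by blast
    obtain c d where c: "c \<in> J" "\<And>t. t \<notin> {c..d} \<Longrightarrow> \<psi> t = 0"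
      using \<psi> test_functions_iff[OF J] by blast
    let ?I = "{min a c..max b d}"
    have out: "\<phi> t = 0" "\<psi> t = 0" if "t \<notin> ?I" for t
    proof -
      have "t \<notin> {a..b}" "t \<notin> {c..d}" using that by auto
      then show "\<phi> t = 0" "\<psi> t = 0" using a(2) c(2) by blast+
    qed
    have min: "min a c \<in> J" using a c by (auto simp: min_def)
    have "((\<lambda>t. sc (\<phi> t) (f t)) has_integral ?T \<phi>) ?I" "((\<lambda>t. sc (\<psi> t) (f t)) has_integral ?T \<psi>) ?I"
      using out by (auto intro!: regular_distribution_eq_integral[OF J f _ min] \<phi> \<psi>)
    from has_integral_add[OF this] have "((\<lambda>t. sc (\<phi> t + \<psi> t) (f t)) has_integral ?T \<phi> + ?T \<psi>) ?I"
      by (simp add: sc.add_left)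
    moreover have "((\<lambda>t. sc (\<phi> t + \<psi> t) (f t)) has_integral ?T (\<lambda>t. \<phi> t + \<psi> t)) ?I"
      using out by (intro regular_distribution_eq_integral[OF J f _ min] test_functions_add[OF J] \<phi> \<psi>) auto
    ultimately show ?thesis by (simp add: has_integral_unique)
  qed
  have T_mult: "?T (\<lambda>t. c * \<phi> t) = sc c (?T \<phi>)" if \<phi>: "\<phi> \<in> test_functions J" for \<phi> c
  proof -
    obtain a b where a: "a \<in> J" "\<And>t. t \<notin> {a..b} \<Longrightarrow> \<phi> t = 0"
      using \<phi> test_functions_iff[OF J] by blast
    have "((\<lambda>t. sc c (sc (\<phi> t) (f t))) has_integral sc c (?T \<phi>)) {a..b}"
      using has_integral_linear[OF regular_distribution_eq_integral[OF J f \<phi> a] sc.bounded_linear_right]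
      by (simp add: o_def)
    moreover have "((\<lambda>t. sc (c * \<phi> t) (f t)) has_integral ?T (\<lambda>t. c * \<phi> t)) {a..b}"
      using a(2) by (intro regular_distribution_eq_integral[OF J f _ a(1)] test_functions_mult[OF J] \<phi>) auto
    ultimately show ?thesis by (simp add: sc_mult has_integral_unique)
  qed
  have bound: "\<exists>C m. \<forall>\<phi>\<in>test_functions J. closure {t. \<phi> t \<noteq> 0} \<subseteq> S \<longrightarrow>
      norm (?T \<phi>) \<le> C * (\<Sum>j\<le>m. SUP t. norm (nth_derivative j \<phi> t))" if S: "compact S" "S \<subseteq> J" for S
  proof -
    obtain a b where a: "a \<in> J" "a \<le> b" "S \<subseteq> {a..b}"
    proof (cases "S = {}")
      case True
      then show ?thesis using that admissible_interval_nonempty[OF J] by blast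
    next
      case False
      obtain a where a: "a \<in> S" "\<And>t. t \<in> S \<Longrightarrow> a \<le> t"
        using compact_attains_inf[OF S(1) False] by blast
      obtain b where "b \<in> S" "\<And>t. t \<in> S \<Longrightarrow> t \<le> b"
        using compact_attains_sup[OF S(1) False] by blast
      with a S(2) show ?thesis by (intro that[of a b]) auto
    qed
    have sub: "{a..b} \<subseteq> J" by (rule admissible_interval_Icc[OF J a(1)])
    have "bounded (f ` {a..b})"
      by (intro compact_imp_bounded compact_continuous_image continuous_on_subset[OF f sub] compact_Icc)
    then obtain B where "\<forall>y\<in>f ` {a..b}. norm y \<le> B" unfolding bounded_iff ..
    then have B: "norm (f t) \<le> B" if "t \<in> {a..b}" for t using that by simp
    have "norm (?T \<phi>) \<le> (B * (b - a)) * (\<Sum>j\<le>0. SUP t. norm (nth_derivative j \<phi> t))"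
      if \<phi>: "\<phi> \<in> test_functions J" and supp: "closure {t. \<phi> t \<noteq> 0} \<subseteq> S" for \<phi>
    proof -
      have 0: "\<phi> t = 0" if "t \<notin> {a..b}" for t
        using that supp a(3) closure_subset[of "{t. \<phi> t \<noteq> 0}"] by blast
      have "bounded (\<phi> ` {a..b})"
        by (intro compact_imp_bounded compact_continuous_image test_function_continuous[OF J \<phi>] compact_Icc)
      then obtain M where "\<forall>y\<in>\<phi> ` {a..b}. norm y \<le> M" unfolding bounded_iff ..
      then have "norm (\<phi> t) \<le> max M 0" for t using 0[of t] by (cases "t \<in> {a..b}") (auto simp: max.coboundedI1)
      then have bdd: "bdd_above (range (\<lambda>t. norm (\<phi> t)))" by (intro bdd_aboveI2)
      have le: "norm (\<phi> t) \<le> (SUP t. norm (\<phi> t))" for t by (rule cSUP_upper[OF _ bdd]) simp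
      have B0: "B \<ge> 0" using B[of a] a(2) norm_ge_zero[of "f a"] by (meson atLeastAtMost_iff order_refl order_trans)
      have "norm (?T \<phi>) \<le> ((SUP t. norm (\<phi> t)) * B) * measure lborel {a..b}"
      proof (rule has_integral_bound_real[OF _ finite.emptyI])
        show "0 \<le> (SUP t. norm (\<phi> t)) * B" using B0 le[of a] norm_ge_zero[of "\<phi> a"] by (intro mult_nonneg_nonneg) linarith+
        show "((\<lambda>t. sc (\<phi> t) (f t)) has_integral ?T \<phi>) {a..b}"
          by (rule regular_distribution_eq_integral[OF J f \<phi> a(1) 0])
        fix t assume "t \<in> {a..b} - {}"
        then show "norm (sc (\<phi> t) (f t)) \<le> (SUP t. norm (\<phi> t)) * B"
          unfolding norm_sc using le[of t] B[of t] by (intro mult_mono') auto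
      qed
      then show ?thesis using a(2) by (simp add: nth_derivative_def mult_ac)
    qed
    then show ?thesis by blast
  qed
  have "?T \<in> extensional (test_functions J)" by (simp add: regular_distribution_def)
  then show ?thesis unfolding distributions_def using T_add T_mult bound by blast
qed

text \<open>
  With \<open>\<Gamma>' = f\<close>, integration by parts moves the derivative from \<open>\<Gamma>\<close> to \<open>M\<^bsub>-h\<^esub> \<phi>\<close>, whose
  derivative is \<open>(\<phi>(t) - \<phi>(t - h)) / h\<close>. A translation of the second term turns the
  result into the integral of \<open>\<phi>\<close> against \<open>(\<Gamma>(t + h) - \<Gamma>(t)) / h = M\<^sub>h f(t)\<close>.
\<close>
lemma mean_dist_regular_distribution:
  assumes J: "admissible_interval J" and f: "continuous_on J f" and h: "h > 0"
    and m: "continuous_on J m" and meq: "\<And>t. t \<in> J \<Longrightarrow> m t = mean h f t"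
  shows "mean_dist J h (regular_distribution sc J f) = regular_distribution sc J m"
proof
  fix \<phi> :: "real \<Rightarrow> 'k"
  show "mean_dist J h (regular_distribution sc J f) \<phi> = regular_distribution sc J m \<phi>"
  proof (cases "\<phi> \<in> test_functions J")
    case False
    then show ?thesis by (simp add: mean_dist_def regular_distribution_def)
  next
    case \<phi>: True
    obtain a b where a: "a \<in> J" "a \<le> b" and supp: "\<And>t. t \<notin> {a..b} \<Longrightarrow> \<phi> t = 0"
      using \<phi> test_functions_iff[OF J] by blast
    let ?M = "mean (- h) \<phi>"
    have M: "?M \<in> test_functions J" and M': "\<And>t. (?M has_vector_derivative (1 / h) *\<^sub>R (\<phi> t - \<phi> (t - h))) (at t)"
      using mean_neg_test_function[OF J \<phi> h] by blast+
    have cont: "continuous_on S \<phi>" for S by (rule test_function_continuous[OF J \<phi>])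
    have int0: "integral {t - h..t} \<phi> = 0" if "\<And>s. s \<in> {t - h<..<t} \<Longrightarrow> \<phi> s = 0" for t
    proof (rule integral_unique)
      show "(\<phi> has_integral 0) {t - h..t}"
        by (rule has_integral_spike_finite[of "{t - h, t}" _ _ "\<lambda>_. 0"]) (use that in auto)
    qed
    have M0: "?M t = 0" if "t \<le> a \<or> b + h \<le> t" for t
      using mean_neg_eq_integral[OF h cont, of t] int0[of t] supp that by auto
    have fJ: "continuous_on {c..d} f" if "c \<in> J" for c d
      by (rule continuous_on_subset[OF f admissible_interval_Icc[OF J that]])
    define \<Gamma> where "\<Gamma> s = integral {a..s} f" for s
    have \<Gamma>': "(\<Gamma> has_vector_derivative f t) (at t within {a..b + h})" if "t \<in> {a..b + h}" for t
      unfolding \<Gamma>_def by (rule integral_has_vector_derivative[OF fJ[OF a(1)] that])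
    then have \<Gamma>cont: "continuous_on {a..b + h} \<Gamma>"
      by (rule continuous_on_vector_derivative)
    have m_eq: "m t = (1 / h) *\<^sub>R (\<Gamma> (t + h) - \<Gamma> t)" if "t \<in> {a..b}" for t
    proof -
      have tJ: "t \<in> J" using that admissible_interval_upward[OF J a(1)] by simp
      have "\<Gamma> t + integral {t..t + h} f = \<Gamma> (t + h)"
        unfolding \<Gamma>_def using that h
        by (intro Henstock_Kurzweil_Integration.integral_combine integrable_continuous_real fJ[OF a(1)]) auto
      then have "integral {t..t + h} f = \<Gamma> (t + h) - \<Gamma> t" by (simp add: eq_diff_eq add.commute)
      then show ?thesis
        using meq[OF tJ] mean_pos_eq_integral[OF h fJ[OF tJ]] by simp
    qed
    have int1: "(\<lambda>t. sc (\<phi> t) (\<Gamma> (t + h))) integrable_on {a..b}"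
      by (intro integrable_continuous_real sc.continuous_on cont continuous_on_compose2[OF \<Gamma>cont] continuous_intros)
        (use h in auto)
    have int2: "(\<lambda>t. sc (\<phi> t) (\<Gamma> t)) integrable_on {a..b}"
      by (intro integrable_continuous_real sc.continuous_on cont continuous_on_subset[OF \<Gamma>cont]) (use h in auto)
    let ?I1 = "integral {a..b} (\<lambda>t. sc (\<phi> t) (\<Gamma> (t + h)))" and ?I2 = "integral {a..b} (\<lambda>t. sc (\<phi> t) (\<Gamma> t))"
    have "((\<lambda>t. sc (\<phi> (t - h)) (\<Gamma> t)) has_integral ?I1) {a + h..b + h}"
      using has_integral_shift_real_ivl[OF integrable_integral[OF int1], of "- h"] by simp
    then have J1: "((\<lambda>t. sc (\<phi> (t - h)) (\<Gamma> t)) has_integral ?I1) {a..b + h}"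
      by (rule has_integral_on_superset) (use h supp in \<open>auto simp: sc.zero_left\<close>)
    have J2: "((\<lambda>t. sc (\<phi> t) (\<Gamma> t)) has_integral ?I2) {a..b + h}"
      using integrable_integral[OF int2]
      by (rule has_integral_on_superset) (use h supp in \<open>auto simp: sc.zero_left\<close>)
    have "((\<lambda>t. sc ((1 / h) *\<^sub>R (\<phi> t - \<phi> (t - h))) (\<Gamma> t)) has_integral (1 / h) *\<^sub>R (?I2 - ?I1)) {a..b + h}"
      using has_integral_cmul[OF has_integral_diff[OF J2 J1], of "1 / h"] by (simp only: sc.scaleR_left sc.diff_left)
    moreover have "(1 / h) *\<^sub>R (?I2 - ?I1) = sc (?M (b + h)) (\<Gamma> (b + h)) - sc (?M a) (\<Gamma> a) - (1 / h) *\<^sub>R (?I1 - ?I2)"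
      by (simp add: M0 sc.zero_left scaleR_diff_right)
    ultimately have "((\<lambda>t. sc ((1 / h) *\<^sub>R (\<phi> t - \<phi> (t - h))) (\<Gamma> t)) has_integral
        sc (?M (b + h)) (\<Gamma> (b + h)) - sc (?M a) (\<Gamma> a) - (1 / h) *\<^sub>R (?I1 - ?I2)) {a..b + h}" by simp
    then have "((\<lambda>t. sc (?M t) (f t)) has_integral (1 / h) *\<^sub>R (?I1 - ?I2)) {a..b + h}"
    proof (rule integration_by_parts_interior[where prod = "\<lambda>x y. sc y x", rotated -1])
      show "bounded_bilinear (\<lambda>x y. sc y x)" by (rule sc.flip)
      show "continuous_on {a..b + h} ?M" by (rule test_function_continuous[OF J M])
      fix t assume t: "t \<in> {a<..<b + h}"
      then show "(\<Gamma> has_vector_derivative f t) (at t)"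
        using \<Gamma>'[of t] by (simp add: at_within_Icc_at)
    qed (use a(2) h \<Gamma>cont M' in auto)
    moreover have "((\<lambda>t. sc (?M t) (f t)) has_integral regular_distribution sc J f ?M) {a..b + h}"
      using M0 by (intro regular_distribution_eq_integral[OF J f M a(1)]) auto
    ultimately have 1: "regular_distribution sc J f ?M = (1 / h) *\<^sub>R (?I1 - ?I2)"
      by (rule has_integral_unique[rotated])
    have "((\<lambda>t. (1 / h) *\<^sub>R (sc (\<phi> t) (\<Gamma> (t + h)) - sc (\<phi> t) (\<Gamma> t))) has_integral (1 / h) *\<^sub>R (?I1 - ?I2)) {a..b}"
      by (intro has_integral_cmul has_integral_diff integrable_integral int1 int2)
    then have "((\<lambda>t. sc (\<phi> t) (m t)) has_integral (1 / h) *\<^sub>R (?I1 - ?I2)) {a..b}"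
      by (rule has_integral_eq[rotated]) (simp add: m_eq sc.scaleR_right sc.diff_right)
    moreover have "((\<lambda>t. sc (\<phi> t) (m t)) has_integral regular_distribution sc J m \<phi>) {a..b}"
      by (rule regular_distribution_eq_integral[OF J m \<phi> a(1) supp])
    ultimately have "regular_distribution sc J m \<phi> = (1 / h) *\<^sub>R (?I1 - ?I2)"
      by (rule has_integral_unique[rotated])
    then show ?thesis using 1 \<phi> by (simp add: mean_dist_def)
  qed
qed

text \<open>
  Test the difference \<open>D\<close> against a bump to the right of \<open>t\<close>, so close to \<open>t\<close> that \<open>D\<close>
  differs there from \<open>D t\<close> by at most half the norm of \<open>D t\<close>.
\<close>
lemma regular_distribution_inj:
  assumes J: "admissible_interval J" and f: "continuous_on J f" and g: "continuous_on J g"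
    and eq: "regular_distribution sc J f = regular_distribution sc J g" and t: "t \<in> J"
  shows "f t = g t"
proof (rule ccontr)
  assume ne: "f t \<noteq> g t"
  define D where "D s = f s - g s" for s
  have D: "D t \<noteq> 0" using ne by (simp add: D_def)
  have sub: "{t..u} \<subseteq> J" for u by (rule admissible_interval_Icc[OF J t])
  have contD: "continuous_on {t..u} D" for u
    unfolding D_def by (intro continuous_intros continuous_on_subset[OF f sub] continuous_on_subset[OF g sub])
  obtain d where d: "d > 0" "\<And>s. s \<in> {t..t + 1} \<Longrightarrow> dist s t < d \<Longrightarrow> dist (D s) (D t) < norm (D t) / 2"
    using contD[of "t + 1"] D unfolding continuous_on_iff
    by (metis atLeastAtMost_iff half_gt_zero_iff le_add_same_cancel1 order_refl zero_le_one zero_less_norm_iff)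
  define u where "u = t + min 1 (d / 2)"
  have u: "t < u" using d(1) by (simp add: u_def)
  have near: "norm (D t - D s) \<le> norm (D t) / 2" if "s \<in> {t..u}" for s
    using d(2)[of s] that d(1) by (auto simp: u_def dist_norm norm_minus_commute min_def split: if_splits)
  obtain F :: "nat \<Rightarrow> real \<Rightarrow> real" where F: "derivative_chain F" "\<And>s. F 0 s \<ge> 0" "\<And>s. F 0 s > 0 \<longleftrightarrow> s \<in> {t<..<u}"
    using bump_function[OF u] by blast
  let ?b = "F 0"
  have b0: "?b s = 0" if "s \<notin> {t..u}" for s using F(2)[of s] F(3)[of s] that by fastforce
  have contb: "continuous_on S ?b" for S by (rule derivative_chain_continuous[OF F(1)])
  have zero: "of_real (?b s) = (0 :: 'k)" if "s \<notin> {t..u}" for s by (simp only: b0[OF that] of_real_0)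
  have "derivative_chain (\<lambda>k s. of_real (F k s) :: 'k)"
    using F(1) unfolding derivative_chain_def
    by (auto intro: bounded_linear.has_vector_derivative[OF bounded_linear_of_real])
  then have \<phi>: "(\<lambda>s. of_real (?b s) :: 'k) \<in> test_functions J"
    by (rule test_functionI[OF J _ _ t _ zero]) (use u in simp_all)
  have "((\<lambda>s. sc (of_real (?b s)) (f s)) has_integral regular_distribution sc J f (\<lambda>s. of_real (?b s))) {t..u}"
    "((\<lambda>s. sc (of_real (?b s)) (g s)) has_integral regular_distribution sc J g (\<lambda>s. of_real (?b s))) {t..u}"
    by (rule regular_distribution_eq_integral[OF J f \<phi> t], simp add: b0)
      (rule regular_distribution_eq_integral[OF J g \<phi> t], simp add: b0)
  from has_integral_diff[OF this] have intD: "((\<lambda>s. ?b s *\<^sub>R D s) has_integral 0) {t..u}"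
    by (simp add: eq sc_of_real D_def scaleR_diff_right)
  have "(?b has_integral integral {t..u} ?b) {t..u}"
    by (intro integrable_integral integrable_continuous_real contb)
  then have "((\<lambda>s. ?b s *\<^sub>R D t) has_integral integral {t..u} ?b *\<^sub>R D t) {t..u}"
    by (rule has_integral_scaleR_left)
  from has_integral_diff[OF this intD]
  have dif: "((\<lambda>s. ?b s *\<^sub>R (D t - D s)) has_integral integral {t..u} ?b *\<^sub>R D t) {t..u}"
    by (simp add: scaleR_diff_right)
  have "norm (integral {t..u} (\<lambda>s. ?b s *\<^sub>R (D t - D s))) \<le> integral {t..u} (\<lambda>s. ?b s * (norm (D t) / 2))"
  proof (rule integral_norm_bound_integral)
    show "(\<lambda>s. ?b s *\<^sub>R (D t - D s)) integrable_on {t..u}" using dif by blast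
    show "(\<lambda>s. ?b s * (norm (D t) / 2)) integrable_on {t..u}"
      by (intro integrable_continuous_real continuous_intros contb)
    show "norm (?b s *\<^sub>R (D t - D s)) \<le> ?b s * (norm (D t) / 2)" if "s \<in> {t..u}" for s
      using mult_left_mono[OF near[OF that] F(2)[of s]] F(2)[of s] by simp
  qed
  then have le: "\<bar>integral {t..u} ?b\<bar> * norm (D t) \<le> integral {t..u} ?b * (norm (D t) / 2)"
    using integral_unique[OF dif] by simp
  have "integral {t..u} ?b \<noteq> 0"
  proof
    assume "integral {t..u} ?b = 0"
    then have "\<forall>s\<in>{t..u}. ?b s = 0"
      using integral_eq_0_iff[OF contb u] F(2) by blast
    moreover have "(t + u) / 2 \<in> {t<..<u}" using u by auto
    ultimately show False using F(3)[of "(t + u) / 2"] by auto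
  qed
  moreover have "integral {t..u} ?b \<ge> 0" using F(2) by (intro integral_nonneg integrable_continuous_real contb) auto
  ultimately have pos: "integral {t..u} ?b > 0" by linarith
  then have "integral {t..u} ?b * norm (D t) > 0" using D by simp
  moreover have "integral {t..u} ?b * norm (D t) \<le> integral {t..u} ?b * norm (D t) / 2"
    using le pos by simp
  ultimately show False by linarith
qed

text \<open>
  Distributions on \<open>J\<close>, with \<open>e\<close> the passage to the regular distribution.
\<close>
lemma avg_class_dist_chain_strict:
  fixes A :: "(real \<Rightarrow> 'x) set"
  assumes "\<exists>x::'x. x \<noteq> 0" and J: "admissible_interval J" and A: "A \<subseteq> C_u J"
    and "real_linear_on J A" and "positive_invariant_on J A"
    and avg: "A \<subseteq> avg_class J A" and "AP_real J \<subseteq> A"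
  shows "(avg_class_dist sc J ^^ n) (regular_distribution sc J ` A)
    \<subset> (avg_class_dist sc J ^^ Suc n) (regular_distribution sc J ` A)"
proof (rule funpow_averaging_strict[where e = "regular_distribution sc J", OF assms(1) J assms(4,5,7)])
  have contA: "continuous_on J f" if "f \<in> A" for f
    using that A uniformly_continuous_imp_continuous unfolding C_u_def by blast
  show "avg_class_dist sc J B \<subseteq> avg_class_dist sc J C" if "B \<subseteq> C" for B C
    using that unfolding avg_class_dist_def by blast
  show "regular_distribution sc J ` A \<subseteq> avg_class_dist sc J (regular_distribution sc J ` A)"
  proof (rule image_subsetI)
    fix f assume f: "f \<in> A"
    have "mean_dist J h (regular_distribution sc J f) \<in> regular_distribution sc J ` A" if "h > 0" for h
    proof -
      have m: "restrict (mean h f) J \<in> A" using f avg that unfolding avg_class_def by blast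
      have "mean_dist J h (regular_distribution sc J f) = regular_distribution sc J (restrict (mean h f) J)"
        by (rule mean_dist_regular_distribution[OF J contA[OF f] that contA[OF m]]) simp
      with m show ?thesis by blast
    qed
    then show "regular_distribution sc J f \<in> avg_class_dist sc J (regular_distribution sc J ` A)"
      using regular_distribution_in_distributions[OF J contA[OF f]] unfolding avg_class_dist_def by blast
  qed
  show "regular_distribution sc J g \<in> regular_distribution sc J ` A" if "restrict g J \<in> A" for g
  proof -
    have "regular_distribution sc J g = regular_distribution sc J (restrict g J)"
      by (rule regular_distribution_cong[OF J]) simp
    with that show ?thesis by blast
  qed
  show "regular_distribution sc J g' \<in> avg_class_dist sc J B \<longleftrightarrow>
      (\<forall>h>0. regular_distribution sc J (diff_quot h g) \<in> B)"
    if g': "continuous_on UNIV g'" and der: "\<And>s. (g has_vector_derivative g' s) (at s)" for g g' :: "real \<Rightarrow> 'x" and B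
  proof -
    have cont: "continuous_on J g'" using g' by (rule continuous_on_subset) simp
    have "continuous_on UNIV (diff_quot h g)" for h
      using funpow_diff_quot_has_vector_derivative[where h = h and n = "Suc 0", OF der]
      by (auto intro!: continuous_at_imp_continuous_on has_vector_derivative_continuous)
    then have contd: "continuous_on J (diff_quot h g)" for h by (rule continuous_on_subset) simp
    have "mean_dist J h (regular_distribution sc J g') = regular_distribution sc J (diff_quot h g)" if "h > 0" for h
      by (rule mean_dist_regular_distribution[OF J cont that contd])
        (simp add: mean_eq_diff_quot[OF J _ that g' der])
    then show ?thesis
      using regular_distribution_in_distributions[OF J cont] unfolding avg_class_dist_def by auto
  qed
  show "uniformly_continuous_on J g"
    if g: "continuous_on UNIV g" and mem: "regular_distribution sc J g \<in> regular_distribution sc J ` A" for g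
  proof -
    obtain a where a: "a \<in> A" "regular_distribution sc J g = regular_distribution sc J a" using mem by blast
    have "continuous_on J g" using g by (rule continuous_on_subset) simp
    then have "g t = a t" if "t \<in> J" for t
      by (rule regular_distribution_inj[OF J _ contA[OF a(1)] a(2) that])
    moreover have "uniformly_continuous_on J a" using a(1) A unfolding C_u_def by blast
    ultimately show ?thesis unfolding uniformly_continuous_on_def by simp
  qed
qed

end

theorem proposition3p8:
  fixes J :: "real set"
    and A :: "(real \<Rightarrow> 'x::banach) set"
    and scaleC :: "complex \<Rightarrow> 'x \<Rightarrow> 'x"
  assumes "\<exists>x::'x. x \<noteq> 0"
    and "admissible_interval J"
    and "A \<subseteq> C_u J"
    and "real_linear_on J A"
    and "positive_invariant_on J A"
    and "A \<subseteq> avg_class J A"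
  shows
    "(AP_real J \<subseteq> A \<longrightarrow>
       (\<forall>n. (avg_class J ^^ n) (ae_closure J A) \<subset> (avg_class J ^^ Suc n) (ae_closure J A)) \<and>
       (open J \<longrightarrow> (\<forall>n.
         (avg_class_dist (scaleR :: real \<Rightarrow> 'x \<Rightarrow> 'x) J ^^ n) (regular_distribution scaleR J ` A)
         \<subset> (avg_class_dist scaleR J ^^ Suc n) (regular_distribution scaleR J ` A)))) \<and>
     (complex_banach_space scaleC \<and> AP_complex scaleC J \<subseteq> A \<longrightarrow>
       (\<forall>n. (avg_class J ^^ n) (ae_closure J A) \<subset> (avg_class J ^^ Suc n) (ae_closure J A)) \<and>
       (open J \<longrightarrow> (\<forall>n.
         (avg_class_dist scaleC J ^^ n) (regular_distribution scaleC J ` A)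
         \<subset> (avg_class_dist scaleC J ^^ Suc n) (regular_distribution scaleC J ` A))))"
proof (intro conjI impI allI)
  fix n
  assume AP: "AP_real J \<subseteq> A"
  show "(avg_class J ^^ n) (ae_closure J A) \<subset> (avg_class J ^^ Suc n) (ae_closure J A)"
    by (rule avg_class_chain_strict[OF assms AP])
  show "(avg_class_dist (scaleR :: real \<Rightarrow> 'x \<Rightarrow> 'x) J ^^ n) (regular_distribution scaleR J ` A)
      \<subset> (avg_class_dist scaleR J ^^ Suc n) (regular_distribution scaleR J ` A)"
    by (rule scalar_action.avg_class_dist_chain_strict[OF scalar_action_scaleR assms AP])
next
  fix n
  assume C: "complex_banach_space scaleC \<and> AP_complex scaleC J \<subseteq> A"
  then have AP: "AP_real J \<subseteq> A" using AP_real_subset_AP_complex by blast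
  show "(avg_class J ^^ n) (ae_closure J A) \<subset> (avg_class J ^^ Suc n) (ae_closure J A)"
    by (rule avg_class_chain_strict[OF assms AP])
  have "scalar_action scaleC"
    using C by (intro complex_banach_space.scalar_action_scaleC) simp
  then show "(avg_class_dist scaleC J ^^ n) (regular_distribution scaleC J ` A)
      \<subset> (avg_class_dist scaleC J ^^ Suc n) (regular_distribution scaleC J ` A)"
    by (rule scalar_action.avg_class_dist_chain_strict[OF _ assms AP])
qed

end
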